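(* Let $\Omega\subset\mathbb{H}$ be an open bounded convex polytope, let $m\in\mathbb{N}$ be the number of hyperplanes of $\partial\Omega$ which are not orthogonal to the hyperplane $\{x_3=0\}$, and write these hyperplanes as $$\Pi_j=\{y\in\mathbb{H}:\ n_{1,j}y_1+n_{2,j}y_2+n_{3,j}y_3=c_j\},\qquad 1\le j\le m,$$ with $n_{1,j},n_{2,j},n_{3,j},c_j\in\mathbb{R}$ and $n_{3,j}\neq0$. Assume that there is a constant $a>0$ such that for all $x\in\Omega$ and all $1\le j\le m$ $$\left(-\frac{2n_{2,j}}{n_{3,j}}+x_1\right)^2+\left(\frac{2n_{1,j}}{n_{3,j}}+x_2\right)^2\;\ge\; a\left|-\frac{c_j}{n_{3,j}}+x_3+\frac{x_1n_{1,j}}{n_{3,j}}+\frac{x_2n_{2,j}}{n_{3,j}}\right|.$$ Then $$\left(\frac{48\sqrt6}{a}+1\right)^{-4/3}\int_\Omega\frac{|u(x)|^2}{\delta_C(x)^2}\,dx\;\le\;4\int_\Omega|\nabla_{\mathbb{H}}u(x)|^2\,dx\qquad\text{for all }u\in C_0^\infty(\Omega).$$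
   Context: $\mathbb{H}$ is the first Heisenberg group: $\mathbb{R}^3$ with the group law $(x_1,x_2,x_3)\boxplus(y_1,y_2,y_3)=\left(x_1+y_1,\;x_2+y_2,\;x_3+y_3-\tfrac12(x_1y_2-x_2y_1)\right)$. Topological notions, convexity, orthogonality and $dx$ (Lebesgue measure) are the Euclidean ones of $\mathbb{R}^3$. The sub-gradient is $\nabla_{\mathbb{H}}=(X_1,X_2)$ with $X_1=\partial_{x_1}+\frac{x_2}{2}\partial_{x_3}$, $X_2=\partial_{x_2}-\frac{x_1}{2}\partial_{x_3}$, so $|\nabla_{\mathbb{H}}u|^2=|X_1u|^2+|X_2u|^2$. A Lipschitz curve $\gamma=(\gamma_1,\gamma_2,\gamma_3):[a,b]\to\mathbb{H}$ is horizontal if $\gamma'(t)\in\mathrm{span}\{(1,0,\gamma_2(t)/2),(0,1,-\gamma_1(t)/2)\}$ (for a.e. $t$). The Carnot-Carathéodory distance is $d_C(x,y)=\inf_\gamma\int_a^b\sqrt{\gamma_1'(t)^2+\gamma_2'(t)^2}\,dt$, the infimum being over all horizontal curves connecting $x$ and $y$. For $x\in\Omega$, $\delta_C(x)=\inf_{y\in\partial\Omega}d_C(x,y)$. The hyperplanes of $\partial\Omega$ are the (distinct) planes in $\mathbb{R}^3$ containing the facets of the polytope. $C_0^\infty(\Omega)$ denotes smooth functions with compact support in $\Omega$. *)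

theory Defs
  imports "HOL-Analysis.Analysis"
begin

text \<open>
  Points of the Heisenberg group are elements of \<^typ>\<open>real^3\<close>.  The group law
  \<open>(x\<^sub>1,x\<^sub>2,x\<^sub>3) \<boxplus> (y\<^sub>1,y\<^sub>2,y\<^sub>3) = (x\<^sub>1+y\<^sub>1, x\<^sub>2+y\<^sub>2, x\<^sub>3+y\<^sub>3 - (x\<^sub>1y\<^sub>2 - x\<^sub>2y\<^sub>1)/2)\<close>
  enters only through its left-invariant vector fields \<open>X1\<close>, \<open>X2\<close>.
\<close>

definition horizontal_plane :: "real^3 \<Rightarrow> (real^3) set" where
  "horizontal_plane x = span {vector [1, 0, x$2 / 2], vector [0, 1, - x$1 / 2]}"

definition horizontal_curve :: "real \<Rightarrow> real \<Rightarrow> (real \<Rightarrow> real^3) \<Rightarrow> bool" where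
  "horizontal_curve a b \<gamma> \<longleftrightarrow>
     (\<exists>L. L-lipschitz_on {a..b} \<gamma>) \<and>
     (AE t in lborel. t \<in> {a..b} \<longrightarrow>
        (\<exists>v \<in> horizontal_plane (\<gamma> t). (\<gamma> has_vector_derivative v) (at t within {a..b})))"

text \<open>
  Lengths and distances are taken in \<^typ>\<open>ennreal\<close>, so that no default value of a real
  infimum or of the integral of a non-integrable function can interfere.
\<close>

definition horizontal_length :: "real \<Rightarrow> real \<Rightarrow> (real \<Rightarrow> real^3) \<Rightarrow> ennreal" where
  "horizontal_length a b \<gamma> =
     (\<integral>\<^sup>+t\<in>{a..b}. ennreal (sqrt ((vector_derivative \<gamma> (at t within {a..b}) $ 1)\<^sup>2
                             + (vector_derivative \<gamma> (at t within {a..b}) $ 2)\<^sup>2)) \<partial>lborel)"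

definition cc_dist :: "real^3 \<Rightarrow> real^3 \<Rightarrow> ennreal" where
  "cc_dist x y =
     Inf {horizontal_length a b \<gamma> | a b \<gamma>. a < b \<and> horizontal_curve a b \<gamma> \<and> \<gamma> a = x \<and> \<gamma> b = y}"

definition cc_dist_frontier :: "(real^3) set \<Rightarrow> real^3 \<Rightarrow> ennreal" where
  "cc_dist_frontier \<Omega> x = (INF y\<in>frontier \<Omega>. cc_dist x y)"

definition partial_deriv :: "3 \<Rightarrow> (real^3 \<Rightarrow> complex) \<Rightarrow> real^3 \<Rightarrow> complex" where
  "partial_deriv i u x = frechet_derivative u (at x) (axis i 1)"

definition X1 :: "(real^3 \<Rightarrow> complex) \<Rightarrow> real^3 \<Rightarrow> complex" where
  "X1 u x = partial_deriv 1 u x + (x$2 / 2) *\<^sub>R partial_deriv 3 u x"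

definition X2 :: "(real^3 \<Rightarrow> complex) \<Rightarrow> real^3 \<Rightarrow> complex" where
  "X2 u x = partial_deriv 2 u x - (x$1 / 2) *\<^sub>R partial_deriv 3 u x"

definition subgrad_norm_sq :: "(real^3 \<Rightarrow> complex) \<Rightarrow> real^3 \<Rightarrow> real" where
  "subgrad_norm_sq u x = (cmod (X1 u x))\<^sup>2 + (cmod (X2 u x))\<^sup>2"

text \<open>\<open>k\<close>-fold continuous differentiability on an open set \<open>S\<close>, by directional derivatives.\<close>

fun Ck_on :: "nat \<Rightarrow> 'a::real_normed_vector set \<Rightarrow> ('a \<Rightarrow> 'b::real_normed_vector) \<Rightarrow> bool" where
  "Ck_on 0 S f \<longleftrightarrow> continuous_on S f"
| "Ck_on (Suc k) S f \<longleftrightarrow>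
     (\<forall>x\<in>S. f differentiable at x) \<and> (\<forall>v. Ck_on k S (\<lambda>x. frechet_derivative f (at x) v))"

text \<open>Elements of \<open>C\<^sub>0\<^sup>\<infinity>(\<Omega>)\<close> are extended by zero outside \<open>\<Omega>\<close>.\<close>

definition C0_infinity :: "(real^3) set \<Rightarrow> (real^3 \<Rightarrow> complex) set" where
  "C0_infinity \<Omega> =
     {u. (\<forall>k. Ck_on k \<Omega> u) \<and> compact (closure {x. u x \<noteq> 0}) \<and> closure {x. u x \<noteq> 0} \<subseteq> \<Omega>}"

text \<open>\<^const>\<open>polytope\<close> is the convex hull of a finite set, hence closed and bounded.\<close>

definition open_convex_polytope :: "(real^3) set \<Rightarrow> bool" where
  "open_convex_polytope \<Omega> \<longleftrightarrow> open \<Omega> \<and> convex \<Omega> \<and> polytope (closure \<Omega>)"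

definition boundary_hyperplanes :: "(real^3) set \<Rightarrow> (real^3) set set" where
  "boundary_hyperplanes \<Omega> = {affine hull F | F. F facet_of closure \<Omega>}"

definition hyperplanes_orthogonal :: "(real^3) set \<Rightarrow> (real^3) set \<Rightarrow> bool" where
  "hyperplanes_orthogonal H K \<longleftrightarrow>
     (\<exists>p q c d. p \<noteq> 0 \<and> q \<noteq> 0 \<and> H = {y. p \<bullet> y = c} \<and> K = {y. q \<bullet> y = d} \<and> orthogonal p q)"

definition nonvertical_hyperplanes :: "(real^3) set \<Rightarrow> (real^3) set set" where
  "nonvertical_hyperplanes \<Omega> =
     {H \<in> boundary_hyperplanes \<Omega>. \<not> hyperplanes_orthogonal H {x. x$3 = 0}}"

end

theory Submission
  imports Defs
begin

text \<open>
  Let \<open>D\<close> be an affine function vanishing on one of the facet planes of \<open>\<Omega>\<close>, and let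
  \<open>W = |\<nabla>\<^sub>H D|\<close> be the length of its sub-gradient.  The inequality is the combination of two
  facts, linked by the quotient \<open>D / W\<close>.

  \<^item> The integral of \<open>|u|\<^sup>2 max (W/D)\<^sup>2\<close>, with the maximum taken over all facet planes, is at most
    four times the integral of \<open>|\<nabla>\<^sub>H u|\<^sup>2\<close> (\<open>subgradient_hardy_hyperplanes\<close>).  An integral
    curve of \<open>X\<^sub>1\<close> or of \<open>X\<^sub>2\<close> is a straight line, so it meets the convex set \<open>\<Omega>\<close> in an
    interval, on which the one-dimensional Hardy inequality holds.  Along the line each
    \<open>D\<close> is affine with slope \<open>X\<^sub>i D\<close> and has no zero in the interval; so \<open>(X\<^sub>i D / D)\<^sup>2\<close> is bounded
    by the one-dimensional weight, for all facet planes at once.  Integrating over all lines is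
    possible because the flow of \<open>X\<^sub>i\<close> consists of shears composed with translations and
    preserves volume.  Finally \<open>(X\<^sub>1 D)\<^sup>2 + (X\<^sub>2 D)\<^sup>2 = W\<^sup>2\<close>.

  \<^item> The Carnot-Caratheodory distance from \<open>x\<close> to the plane \<open>D = 0\<close> is at least \<open>k |D(x)| / W(x)\<close>
    with \<open>k = (48 \<surd>6 / a + 1)\<^sup>-\<^sup>2\<^sup>/\<^sup>3\<close> (\<open>cc_dist_hyperplane_lower_bound\<close>).  A horizontal curve of
    length \<open>l\<close> from \<open>x\<close> moves its horizontal projection by at most \<open>l\<close>, hence changes \<open>\<nabla>\<^sub>H D\<close> by at
    most \<open>|n\<^sub>3| l / 2\<close>, and \<open>D\<close> by at most \<open>(W(x) + |n\<^sub>3| l / 2) l\<close>.  The hypothesis on \<open>\<Omega>\<close> says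
    \<open>a |n\<^sub>3| |D| \<le> 4 W\<^sup>2\<close>, which makes the quadratic term comparable with the linear one.

  Vertical planes have \<open>n\<^sub>3 = 0\<close> and satisfy the last inequality trivially, so both kinds of
  facets are treated alike.
\<close>

section \<open>Lipschitz curves and horizontal length\<close>

text \<open>
  The weight of the theorem contains the distance to the boundary, and the derivative of a
  Lipschitz curve is only known almost everywhere.  The next two lemmas allow constants to be
  moved through integrals of such functions, whose measurability is not at hand.
\<close>

lemma cmult_nn_integral_le:
  "c * (\<integral>\<^sup>+x. f x \<partial>M) \<le> (\<integral>\<^sup>+x. c * f x \<partial>M)"
proof -
  have "c * integral\<^sup>S M g \<le> (\<integral>\<^sup>+x. c * f x \<partial>M)" if g: "simple_function M g" "g \<le> f" for g
  proof -
    have "c * integral\<^sup>S M g = integral\<^sup>S M (\<lambda>x. c * g x)"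
      using g by simp
    also have "\<dots> = (\<integral>\<^sup>+x. c * g x \<partial>M)"
      using g by (intro nn_integral_eq_simple_integral[symmetric]) auto
    also have "\<dots> \<le> (\<integral>\<^sup>+x. c * f x \<partial>M)"
      using g by (intro nn_integral_mono mult_left_mono) (auto simp: le_fun_def)
    finally show ?thesis .
  qed
  then have "(SUP g\<in>{g. simple_function M g \<and> g \<le> f}. c * integral\<^sup>S M g) \<le> (\<integral>\<^sup>+x. c * f x \<partial>M)"
    by (intro SUP_least) auto
  then show ?thesis
    by (simp add: nn_integral_def[of M f] SUP_mult_left_ennreal)
qed

lemma nn_integral_cmult_le:
  assumes "C \<ge> 0"
  shows "(\<integral>\<^sup>+x. ennreal C * f x \<partial>M) \<le> ennreal C * (\<integral>\<^sup>+x. f x \<partial>M)"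
proof (cases "C = 0")
  case False
  with assms have C: "C > 0" by simp
  have inv: "ennreal C * (ennreal (1 / C) * y) = y" "ennreal (1 / C) * (ennreal C * y) = y" for y
    using C by (simp_all add: mult.assoc[symmetric] ennreal_mult[symmetric])
  have "ennreal (1 / C) * (\<integral>\<^sup>+x. ennreal C * f x \<partial>M) \<le> (\<integral>\<^sup>+x. f x \<partial>M)"
    using cmult_nn_integral_le[of "ennreal (1 / C)" M "\<lambda>x. ennreal C * f x"] by (simp add: inv)
  then have "ennreal C * (ennreal (1 / C) * (\<integral>\<^sup>+x. ennreal C * f x \<partial>M)) \<le> ennreal C * (\<integral>\<^sup>+x. f x \<partial>M)"
    by (rule mult_left_mono) simp
  then show ?thesis by (simp add: inv)
qed simp

lemma has_vector_derivative_quotient_seq: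
  fixes f :: "real \<Rightarrow> 'a::real_normed_vector"
  assumes f: "(f has_vector_derivative d) (at x)" and k: "k \<longlonglongrightarrow> 0" "\<And>n. k n \<noteq> 0"
  shows "(\<lambda>n. (f (x + k n) - f x) /\<^sub>R k n) \<longlonglongrightarrow> d"
proof -
  have "((\<lambda>h. norm (f (x + h) - f x - h *\<^sub>R d) / norm h) \<longlongrightarrow> 0) (at 0)"
    using f by (simp add: has_vector_derivative_def has_derivative_at)
  moreover have "filterlim k (at 0) sequentially"
    using k by (simp add: filterlim_at)
  ultimately have "(\<lambda>n. norm (f (x + k n) - f x - k n *\<^sub>R d) / norm (k n)) \<longlonglongrightarrow> 0"
    by (rule filterlim_compose)
  moreover have "norm (f (x + k n) - f x - k n *\<^sub>R d) / norm (k n)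
      = norm ((f (x + k n) - f x) /\<^sub>R k n - d)" for n
  proof -
    have "(f (x + k n) - f x) /\<^sub>R k n - d = (f (x + k n) - f x - k n *\<^sub>R d) /\<^sub>R k n"
      using k(2)[of n] by (simp add: scaleR_diff_right)
    then show ?thesis by (simp add: divide_inverse mult.commute)
  qed
  ultimately show ?thesis
    by (simp add: tendsto_norm_zero_iff LIM_zero_iff)
qed

text \<open>
  A Lipschitz curve is recovered from its almost everywhere derivative: the difference
  quotients are bounded by the Lipschitz constant, so dominated convergence applies, while
  their integrals are differences of averages of the curve near the end points.
\<close>

lemma lipschitz_norm_diff_le_nn_integral:
  fixes f f' :: "real \<Rightarrow> 'a::euclidean_space"
  assumes ab: "a \<le> b"
    and lip: "L-lipschitz_on {a..b} f"
    and deriv: "AE t in lborel. t \<in> {a..b} \<longrightarrow> (f has_vector_derivative f' t) (at t within {a..b})"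
  shows "ennreal (norm (f b - f a)) \<le> (\<integral>\<^sup>+t\<in>{a..b}. ennreal (norm (f' t)) \<partial>lborel)"
proof -
  \<comment> \<open>The constant extension, so that difference quotients make sense beyond \<open>b\<close>.\<close>
  define g where "g t = f (max a (min b t))" for t
  have L: "L \<ge> 0" using lip by (rule lipschitz_on_nonneg)
  have g_lip: "norm (g s - g t) \<le> L * \<bar>s - t\<bar>" for s t
  proof -
    have "norm (g s - g t) \<le> L * \<bar>max a (min b s) - max a (min b t)\<bar>"
      unfolding g_def using lipschitz_on_normD[OF lip, of "max a (min b s)" "max a (min b t)"] ab
      by (auto simp: dist_norm)
    also have "\<dots> \<le> L * \<bar>s - t\<bar>"
      by (intro mult_left_mono L) (auto simp: max_def min_def)
    finally show ?thesis .
  qed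
  have "L-lipschitz_on UNIV g"
    using g_lip L by (intro lipschitz_onI) (auto simp: dist_norm)
  then have g_cont: "continuous_on S g" for S
    using lipschitz_on_continuous_on continuous_on_subset by blast
  have [measurable]: "g \<in> borel_measurable borel"
    using g_cont by (rule borel_measurable_continuous_onI)
  obtain G where G: "\<And>x. x \<in> {a-1..b+2} \<Longrightarrow> (G has_vector_derivative g x) (at x within {a-1..b+2})"
    using antiderivative_continuous[OF g_cont] by metis
  have G': "(G has_vector_derivative g x) (at x)" if "a - 1 < x" "x < b + 2" for x
    using G[of x] that by (simp add: at_within_Icc_at)
  define h where "h n = inverse (real (Suc n))" for n
  have h: "0 < h n" "h n \<le> 1" for n by (auto simp: h_def field_simps)
  have h0: "h \<longlonglongrightarrow> 0"
    unfolding h_def by (rule LIMSEQ_inverse_real_of_nat)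
  define D where "D n t = indicator {a..b} t *\<^sub>R ((g (t + h n) - g t) /\<^sub>R h n)" for n t
  have [measurable]: "D n \<in> borel_measurable borel" for n
    unfolding D_def by measurable
  \<comment> \<open>A Borel measurable version of the derivative.\<close>
  define F where "F t = lim (\<lambda>n. D n t)" for t
  have [measurable]: "F \<in> borel_measurable borel"
    unfolding F_def by measurable
  have conv: "AE t in lborel. (\<lambda>n. D n t) \<longlonglongrightarrow> indicator {a..b} t *\<^sub>R f' t"
    using deriv AE_lborel_singleton[of a] AE_lborel_singleton[of b]
  proof eventually_elim
    case (elim t)
    show ?case
    proof (cases "t \<in> {a..b}")
      case False
      then show ?thesis by (simp add: D_def)
    next
      case True
      with elim have t: "a < t" "t < b" by auto
      have f_at: "(f has_vector_derivative f' t) (at t)"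
        using elim t True by (simp add: at_within_Icc_at)
      have "(g has_vector_derivative f' t) (at t)"
      proof (rule has_vector_derivative_transform_within_open[OF f_at, of "{a<..<b}"])
      qed (use t in \<open>auto simp: g_def\<close>)
      then have "(\<lambda>n. (g (t + h n) - g t) /\<^sub>R h n) \<longlonglongrightarrow> f' t"
        using h0 h by (intro has_vector_derivative_quotient_seq) (auto simp: less_imp_neq[symmetric])
      then show ?thesis using True by (simp add: D_def)
    qed
  qed
  have bound: "norm (D n t) \<le> indicator {a..b} t * L" for n t
  proof -
    have "norm ((g (t + h n) - g t) /\<^sub>R h n) \<le> L"
      using g_lip[of "t + h n" t] h[of n] unfolding norm_scaleR by (simp add: field_simps)
    then show ?thesis by (auto simp: D_def indicator_def)
  qed
  have F_AE: "AE t in lborel. F t = indicator {a..b} t *\<^sub>R f' t"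
    using conv by eventually_elim (auto simp: F_def limI)
  have "integrable lborel (\<lambda>t. indicator {a..b} t * L)"
    by (intro integrable_mult_left integrable_real_indicator) (auto simp: emeasure_lborel_Icc_eq)
  note DCT = this
  have lim_F: "(\<lambda>n. integral\<^sup>L lborel (D n)) \<longlonglongrightarrow> integral\<^sup>L lborel F"
    and int_F: "integrable lborel F"
  proof -
    have 1: "AE t in lborel. (\<lambda>n. D n t) \<longlonglongrightarrow> F t"
      using conv F_AE by eventually_elim simp
    show "(\<lambda>n. integral\<^sup>L lborel (D n)) \<longlonglongrightarrow> integral\<^sup>L lborel F"
      by (rule integral_dominated_convergence[OF _ _ DCT 1]) (auto simp: bound)
    show "integrable lborel F"
      by (rule integrable_dominated_convergence[OF _ _ DCT 1]) (auto simp: bound)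
  qed
  have int_D: "integral\<^sup>L lborel (D n) = (G (b + h n) - G b) /\<^sub>R h n - (G (a + h n) - G a) /\<^sub>R h n" for n
  proof -
    have "integral\<^sup>L lborel (D n) = (G (b + h n) - G b) /\<^sub>R h n - (G (a + h n) - G a) /\<^sub>R h n"
      unfolding D_def[abs_def]
    proof (rule integral_FTC_Icc[OF ab])
      fix x assume x: "a \<le> x" "x \<le> b"
      have "((\<lambda>t. t + h n) has_real_derivative 1) (at x)"
        by (auto intro!: derivative_eq_intros)
      then have "((\<lambda>t. t + h n) has_vector_derivative 1) (at x)"
        by (simp add: has_real_derivative_iff_has_vector_derivative)
      from vector_diff_chain_at[OF this G'[of "x + h n"]]
      have "((\<lambda>t. G (t + h n)) has_vector_derivative g (x + h n)) (at x)"
        using x h[of n] by (simp add: o_def)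
      from has_vector_derivative_diff[OF this G'[of x]]
      have "((\<lambda>t. G (t + h n) - G t) has_vector_derivative g (x + h n) - g x) (at x)"
        using x by simp
      from bounded_linear.has_vector_derivative[OF bounded_linear_scaleR_right this]
      show "((\<lambda>t. (G (t + h n) - G t) /\<^sub>R h n) has_vector_derivative
          (g (x + h n) - g x) /\<^sub>R h n) (at x within {a..b})"
        by (rule has_vector_derivative_at_within)
    next
      show "continuous_on {a..b} (\<lambda>x. (g (x + h n) - g x) /\<^sub>R h n)"
        by (intro continuous_intros continuous_on_compose2[OF g_cont[of UNIV]]) auto
    qed
    then show ?thesis .
  qed
  have quot: "(\<lambda>n. (G (x + h n) - G x) /\<^sub>R h n) \<longlonglongrightarrow> g x" if "a - 1 < x" "x < b + 2" for x
    using G'[OF that] h0 h by (intro has_vector_derivative_quotient_seq) (auto simp: less_imp_neq[symmetric])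
  have "(\<lambda>n. integral\<^sup>L lborel (D n)) \<longlonglongrightarrow> g b - g a"
    unfolding int_D using ab by (intro tendsto_diff quot) auto
  with lim_F have "integral\<^sup>L lborel F = g b - g a"
    by (rule LIMSEQ_unique)
  then have "f b - f a = integral\<^sup>L lborel F"
    using ab by (simp add: g_def)
  also have "ennreal (norm \<dots>) \<le> (\<integral>\<^sup>+t. ennreal (norm (F t)) \<partial>lborel)"
    using int_F by (rule integral_norm_bound_ennreal)
  also have "\<dots> = (\<integral>\<^sup>+t\<in>{a..b}. ennreal (norm (f' t)) \<partial>lborel)"
    using F_AE by (intro nn_integral_cong_AE, eventually_elim) (auto simp: indicator_def)
  finally show ?thesis .
qed

text \<open>
  Horizontal directions are encoded as complex numbers, so that horizontal length becomes the
  modulus and the \<open>\<pi>/2\<close> rotation hidden in the vector fields becomes multiplication by \<open>\<i>\<close>.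
\<close>

definition hproj :: "real^3 \<Rightarrow> complex" where
  "hproj v = Complex (v$1) (v$2)"

text \<open>
  The sub-gradient at \<open>x\<close> of an affine function with Euclidean gradient \<open>p\<close>.  It depends on \<open>x\<close>
  only through the horizontal projection.
\<close>

definition hgrad :: "real^3 \<Rightarrow> real^3 \<Rightarrow> complex" where
  "hgrad p x = Complex (p$1 + p$3 * x$2 / 2) (p$2 - p$3 * x$1 / 2)"

lemma bounded_linear_hproj: "bounded_linear hproj"
proof -
  have "linear hproj"
    by (intro linearI) (auto simp: hproj_def complex_eq_iff)
  then show ?thesis by (simp add: linear_conv_bounded_linear)
qed

lemma norm_hproj: "norm (hproj v) = sqrt ((v$1)\<^sup>2 + (v$2)\<^sup>2)"
  by (simp add: hproj_def complex_norm)

lemma norm_hgrad_diff: "norm (hgrad p y - hgrad p x) = \<bar>p$3\<bar> / 2 * norm (hproj y - hproj x)"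
proof -
  have "hgrad p y - hgrad p x = (- \<i> * complex_of_real (p$3 / 2)) * (hproj y - hproj x)"
    by (simp add: hgrad_def hproj_def complex_eq_iff algebra_simps diff_divide_distrib)
  then show ?thesis by (simp add: norm_mult)
qed

lemma inner_horizontal:
  assumes "v \<in> horizontal_plane x"
  shows "p \<bullet> v = hgrad p x \<bullet> hproj v"
proof -
  have "subspace {v. p \<bullet> v = hgrad p x \<bullet> hproj v}"
    by (intro subspaceI)
       (auto simp: inner_add_right hproj_def inner_complex_def algebra_simps)
  then have "horizontal_plane x \<subseteq> {v. p \<bullet> v = hgrad p x \<bullet> hproj v}"
    unfolding horizontal_plane_def
    by (intro span_minimal)
       (auto simp: hgrad_def hproj_def inner_vec_def sum_3 inner_complex_def algebra_simps)
  with assms show ?thesis by blast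
qed

text \<open>
  The horizontal projection of the curve stays within \<open>l\<close> of its starting point, so the
  sub-gradient of the affine function, which is a rotated and scaled copy of that projection,
  is bounded along the whole curve; the affine function grows at most by this bound times \<open>l\<close>.
\<close>

lemma horizontal_curve_affine_bound:
  assumes ab: "a < b" and \<gamma>: "horizontal_curve a b \<gamma>"
    and len: "horizontal_length a b \<gamma> = ennreal l" and l: "l \<ge> 0"
  shows "\<bar>p \<bullet> (\<gamma> b - \<gamma> a)\<bar> \<le> (norm (hgrad p (\<gamma> a)) + \<bar>p$3\<bar> / 2 * l) * l"
proof -
  define v where "v t = vector_derivative \<gamma> (at t within {a..b})" for t
  obtain L where lip: "L-lipschitz_on {a..b} \<gamma>"
    using \<gamma> by (auto simp: horizontal_curve_def)
  have "AE t in lborel. t \<in> {a..b} \<longrightarrow>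
        (\<exists>v \<in> horizontal_plane (\<gamma> t). (\<gamma> has_vector_derivative v) (at t within {a..b}))"
    using \<gamma> by (simp add: horizontal_curve_def)
  then have v: "AE t in lborel. t \<in> {a..b} \<longrightarrow>
        v t \<in> horizontal_plane (\<gamma> t) \<and> (\<gamma> has_vector_derivative v t) (at t within {a..b})"
  proof eventually_elim
    case (elim t)
    show ?case
    proof
      assume t: "t \<in> {a..b}"
      with elim obtain w where w: "w \<in> horizontal_plane (\<gamma> t)"
        "(\<gamma> has_vector_derivative w) (at t within {a..b})" by blast
      have "v t = w"
        unfolding v_def using vector_derivative_within_cbox[of a b t \<gamma> w] ab t w by simp
      with w show "v t \<in> horizontal_plane (\<gamma> t) \<and> (\<gamma> has_vector_derivative v t) (at t within {a..b})"
        by simp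
    qed
  qed
  have len': "(\<integral>\<^sup>+t\<in>{a..b}. ennreal (norm (hproj (v t))) \<partial>lborel) = ennreal l"
    using len by (simp add: horizontal_length_def norm_hproj v_def)
  have lip_comp: "\<exists>K. K-lipschitz_on {a..b} (\<lambda>t. F (\<gamma> t))" if F: "bounded_linear F"
    for F :: "real^3 \<Rightarrow> 'b::real_normed_vector"
  proof -
    obtain B where "B-lipschitz_on (\<gamma> ` {a..b}) F"
      using bounded_linear.lipschitz_boundE[OF F] by blast
    then show ?thesis using lipschitz_on_compose2[OF lip] by blast
  qed
  \<comment> \<open>The projected curve has length at most \<open>l\<close>.\<close>
  have near: "norm (hproj (\<gamma> s) - hproj (\<gamma> a)) \<le> l" if s: "s \<in> {a..b}" for s
  proof -
    obtain K where K: "K-lipschitz_on {a..b} (\<lambda>t. hproj (\<gamma> t))"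
      using lip_comp[OF bounded_linear_hproj] by blast
    have "ennreal (norm (hproj (\<gamma> s) - hproj (\<gamma> a)))
        \<le> (\<integral>\<^sup>+t\<in>{a..s}. ennreal (norm (hproj (v t))) \<partial>lborel)"
    proof (rule lipschitz_norm_diff_le_nn_integral)
      show "K-lipschitz_on {a..s} (\<lambda>t. hproj (\<gamma> t))"
        using K s by (auto intro: lipschitz_on_subset)
      show "AE t in lborel. t \<in> {a..s} \<longrightarrow>
          ((\<lambda>t. hproj (\<gamma> t)) has_vector_derivative hproj (v t)) (at t within {a..s})"
        using v
      proof eventually_elim
        case (elim t)
        then show ?case
          using s by (auto intro!: bounded_linear.has_vector_derivative[OF bounded_linear_hproj]
              intro: has_vector_derivative_within_subset)
      qed
    qed (use s in auto)
    also have "\<dots> \<le> (\<integral>\<^sup>+t\<in>{a..b}. ennreal (norm (hproj (v t))) \<partial>lborel)"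
      using s by (intro nn_integral_mono) (auto simp: indicator_def)
    finally show ?thesis using l by (simp add: len')
  qed
  define C where "C = norm (hgrad p (\<gamma> a)) + \<bar>p$3\<bar> / 2 * l"
  have C: "C \<ge> 0" using l by (simp add: C_def)
  obtain K where K: "K-lipschitz_on {a..b} (\<lambda>t. p \<bullet> \<gamma> t)"
    using lip_comp[OF bounded_linear_inner_right[of p]] by blast
  have "ennreal (norm (p \<bullet> \<gamma> b - p \<bullet> \<gamma> a)) \<le> (\<integral>\<^sup>+t\<in>{a..b}. ennreal (norm (p \<bullet> v t)) \<partial>lborel)"
  proof (rule lipschitz_norm_diff_le_nn_integral[OF _ K])
    show "AE t in lborel. t \<in> {a..b} \<longrightarrow>
        ((\<lambda>t. p \<bullet> \<gamma> t) has_vector_derivative p \<bullet> v t) (at t within {a..b})"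
      using v by eventually_elim
        (auto intro!: bounded_linear.has_vector_derivative[OF bounded_linear_inner_right])
  qed (use ab in simp)
  also have "\<dots> \<le> (\<integral>\<^sup>+t. ennreal C * (ennreal (norm (hproj (v t))) * indicator {a..b} t) \<partial>lborel)"
  proof (rule nn_integral_mono_AE, use v in eventually_elim)
    case (elim t)
    show ?case
    proof (cases "t \<in> {a..b}")
      case True
      have "norm (hgrad p (\<gamma> t)) \<le> norm (hgrad p (\<gamma> a)) + norm (hgrad p (\<gamma> t) - hgrad p (\<gamma> a))"
        by (metis add.commute diff_add_cancel norm_triangle_ineq)
      also have "\<dots> \<le> C"
        unfolding norm_hgrad_diff C_def using near[OF True] by (intro add_mono mult_left_mono) auto
      finally have "norm (hgrad p (\<gamma> t)) \<le> C" .
      have "\<bar>p \<bullet> v t\<bar> = \<bar>hgrad p (\<gamma> t) \<bullet> hproj (v t)\<bar>"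
        using inner_horizontal[of "v t" "\<gamma> t" p] elim True by simp
      also have "\<dots> \<le> norm (hgrad p (\<gamma> t)) * norm (hproj (v t))"
        by (rule Cauchy_Schwarz_ineq2)
      also have "\<dots> \<le> C * norm (hproj (v t))"
        using \<open>norm (hgrad p (\<gamma> t)) \<le> C\<close> by (rule mult_right_mono) simp
      finally have "\<bar>p \<bullet> v t\<bar> \<le> C * norm (hproj (v t))" .
      then show ?thesis using True C by (simp add: ennreal_mult[symmetric] ennreal_leI)
    qed simp
  qed
  also have "\<dots> \<le> ennreal C * ennreal l"
    using nn_integral_cmult_le[OF C, of lborel "\<lambda>t. ennreal (norm (hproj (v t))) * indicator {a..b} t"]
    by (simp add: len')
  also have "\<dots> = ennreal (C * l)"
    using C l by (simp add: ennreal_mult)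
  finally have "\<bar>p \<bullet> \<gamma> b - p \<bullet> \<gamma> a\<bar> \<le> C * l"
    using C l by (simp del: ennreal_mult')
  then show ?thesis by (simp add: inner_diff_right C_def)
qed
text \<open>
  With \<open>z = l W / D\<close> the hypotheses give \<open>1 \<le> z + 2 z\<^sup>2 / a\<close>, so it suffices that
  \<open>k + 2 k\<^sup>2 / a \<le> 1\<close> for the constant \<open>k\<close>.  Writing \<open>k = q\<^sup>-\<^sup>2\<close>, so that
  \<open>q\<^sup>3 = 48 \<surd>6 / a + 1\<close>, this is the polynomial inequality \<open>q\<^sup>2 + 2 / a \<le> q\<^sup>4\<close> for \<open>q \<ge> 1\<close>,
  where \<open>2 / a \<le> (q\<^sup>3 - 1) / 3\<close>.
\<close>

lemma horizontal_length_lower_bound: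
  fixes a D W T l :: real
  assumes a: "a > 0" and D: "D > 0" and W: "W > 0" and l: "l \<ge> 0" and T: "T \<ge> 0"
    and TD: "a * T * D \<le> 4 * W\<^sup>2" and Dl: "D \<le> (W + T / 2 * l) * l"
  shows "(48 * sqrt 6 / a + 1) powr (- 2 / 3) * D / W \<le> l"
proof (rule ccontr)
  define q where "q = (48 * sqrt 6 / a + 1) powr (1 / 3)"
  define k where "k = (48 * sqrt 6 / a + 1) powr (- 2 / 3)"
  have base: "48 * sqrt 6 / a + 1 \<ge> 1" using a by simp
  have q1: "q \<ge> 1" using base by (simp add: q_def ge_one_powr_ge_zero)
  have q3: "q ^ 3 = 48 * sqrt 6 / a + 1"
    using base by (simp add: q_def powr_powr flip: powr_realpow')
  have k: "k = 1 / q ^ 2"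
    using base by (simp add: k_def q_def powr_powr powr_minus_divide flip: powr_realpow')
  have k0: "k > 0" using q1 by (simp add: k)
  have "1 \<le> sqrt 6" by simp
  then have "6 \<le> 48 * sqrt 6" by linarith
  then have "6 / a \<le> q ^ 3 - 1"
    using a divide_right_mono[of 6 "48 * sqrt 6" a] by (simp add: q3)
  then have inv_a: "2 / a \<le> (q ^ 3 - 1) / 3" by simp
  have "q ^ 4 - q ^ 2 - (q ^ 3 - 1) / 3 = (q - 1) * (q ^ 3 + q * (2 * q - 1) / 3 - 1 / 3)"
    by (simp add: field_simps power_numeral_reduce)
  also have "\<dots> \<ge> 0"
  proof -
    have "q ^ 3 \<ge> 1" using q1 by simp
    moreover have "q * (2 * q - 1) \<ge> 0" using q1 by simp
    ultimately have "q ^ 3 + q * (2 * q - 1) / 3 - 1 / 3 \<ge> 0" by linarith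
    then show ?thesis using q1 by (intro mult_nonneg_nonneg) auto
  qed
  finally have "q ^ 2 + 2 / a \<le> q ^ 4" using inv_a by linarith
  then have "(q ^ 2 + 2 / a) / q ^ 4 \<le> 1" using q1 by simp
  moreover have "(q ^ 2 + 2 / a) / q ^ 4 = k + 2 * k\<^sup>2 / a"
    using q1 by (simp add: k field_simps power_numeral_reduce)
  ultimately have small: "k + 2 * k\<^sup>2 / a \<le> 1" by simp
  assume "\<not> ?thesis"
  then have lt: "l < k * D / W" by (simp add: k_def)
  define z where "z = l * W / D"
  have z: "0 \<le> z" "z < k" using lt D W l by (auto simp: z_def field_simps)
  have lz: "l = z * D / W" using D W by (simp add: z_def)
  have "T * D / W\<^sup>2 \<le> 4 / a" using TD a W by (simp add: field_simps)
  have "1 = D / D" using D by simp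
  also have "\<dots> \<le> (W + T / 2 * l) * l / D" using Dl D by (intro divide_right_mono) auto
  also have "\<dots> = z + z\<^sup>2 * (T * D / W\<^sup>2) / 2"
    using D W by (simp add: lz field_simps power2_eq_square)
  also have "\<dots> \<le> z + z\<^sup>2 * (4 / a) / 2"
    using \<open>T * D / W\<^sup>2 \<le> 4 / a\<close> by (intro add_left_mono divide_right_mono mult_left_mono) auto
  also have "\<dots> < k + k\<^sup>2 * (4 / a) / 2"
    using z a by (intro add_less_le_mono divide_right_mono mult_right_mono power_mono) auto
  also have "\<dots> \<le> 1" using small by simp
  finally show False by simp
qed

lemma cc_dist_hyperplane_lower_bound:
  assumes a: "a > 0" and x: "p \<bullet> x \<noteq> c" and y: "p \<bullet> y = c" and W: "hgrad p x \<noteq> 0"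
    and bound: "a * \<bar>p$3\<bar> * \<bar>p \<bullet> x - c\<bar> \<le> 4 * (norm (hgrad p x))\<^sup>2"
  shows "ennreal ((48 * sqrt 6 / a + 1) powr (- 2 / 3) * \<bar>p \<bullet> x - c\<bar> / norm (hgrad p x)) \<le> cc_dist x y"
  unfolding cc_dist_def
proof (rule Inf_greatest, clarify)
  fix s t \<gamma>
  assume *: "s < t" "horizontal_curve s t \<gamma>" "x = \<gamma> s" "y = \<gamma> t"
  show "ennreal ((48 * sqrt 6 / a + 1) powr (- 2 / 3) * \<bar>p \<bullet> \<gamma> s - c\<bar> / norm (hgrad p (\<gamma> s)))
      \<le> horizontal_length s t \<gamma>"
  proof (cases "horizontal_length s t \<gamma>")
    case (real l)
    have "\<bar>p \<bullet> \<gamma> s - c\<bar> \<le> (norm (hgrad p (\<gamma> s)) + \<bar>p$3\<bar> / 2 * l) * l"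
      using horizontal_curve_affine_bound[OF *(1,2) real(2,1), of p] y *
      by (simp add: inner_diff_right abs_minus_commute)
    then have "(48 * sqrt 6 / a + 1) powr (- 2 / 3) * \<bar>p \<bullet> \<gamma> s - c\<bar> / norm (hgrad p (\<gamma> s)) \<le> l"
      using real x W bound * by (intro horizontal_length_lower_bound[OF a]) auto
    then show ?thesis using real by (simp add: ennreal_leI)
  qed simp
qed

section \<open>The Hardy inequality on an interval\<close>

text \<open>
  The weight is that of the ground state \<open>\<surd>((s - \<alpha>) (\<beta> - s))\<close>: with \<open>V\<close> its logarithmic
  derivative, \<open>|g' - V g|\<^sup>2 \<ge> 0\<close> expands to the inequality up to the exact derivative of
  \<open>V |g|\<^sup>2\<close>, which vanishes at both ends of the support.  This symmetric weight dominates the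
  inverse square of the distance to either end point.
\<close>

lemma hardy_interval:
  fixes g g' :: "real \<Rightarrow> 'a::euclidean_space"
  assumes deriv: "\<And>s. (g has_vector_derivative g' s) (at s)"
    and cont: "continuous_on UNIV g'"
    and order: "\<alpha> < r" "r < t" "t < \<beta>"
    and supp: "\<And>s. s \<notin> {r<..<t} \<Longrightarrow> g s = 0"
  shows "(\<integral>\<^sup>+s\<in>{\<alpha><..<\<beta>}. ennreal ((norm (g s))\<^sup>2 * (1 / (s - \<alpha>) + 1 / (\<beta> - s))\<^sup>2) \<partial>lborel)
    \<le> 4 * (\<integral>\<^sup>+s\<in>{\<alpha><..<\<beta>}. ennreal ((norm (g' s))\<^sup>2) \<partial>lborel)"
proof -
  define f where "f s = (norm (g s))\<^sup>2" for s
  define f' where "f' s = 2 * (g s \<bullet> g' s)" for s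
  define V where "V s = (1 / (s - \<alpha>) - 1 / (\<beta> - s)) / 2" for s
  define V' where "V' s = - (1 / (s - \<alpha>)\<^sup>2 + 1 / (\<beta> - s)\<^sup>2) / 2" for s
  define A where "A s = f s * (1 / (s - \<alpha>) + 1 / (\<beta> - s))\<^sup>2" for s
  define B where "B s = 4 * (norm (g' s))\<^sup>2" for s
  define P' where "P' s = V' s * f s + V s * f' s" for s
  have g_cont: "continuous_on S g" for S
    using deriv by (meson continuous_at_imp_continuous_on has_vector_derivative_continuous)
  have g'_cont: "continuous_on S g'" for S
    using cont continuous_on_subset by blast
  have f_deriv: "(f has_real_derivative f' s) (at s)" for s
    using deriv[of s] unfolding f_def[abs_def] f'_def has_vector_derivative_def has_field_derivative_def
      power2_norm_eq_inner
    by (auto intro!: derivative_eq_intros simp: inner_commute algebra_simps fun_eq_iff)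
  have V_deriv: "(V has_real_derivative V' s) (at s)" if "s \<in> {r..t}" for s
  proof -
    have "((\<lambda>s. 1 / (s - \<alpha>)) has_real_derivative - (1 / (s - \<alpha>)\<^sup>2)) (at s)"
      and "((\<lambda>s. 1 / (\<beta> - s)) has_real_derivative 1 / (\<beta> - s)\<^sup>2) (at s)"
      using that order by (auto intro!: derivative_eq_intros simp: power2_eq_square)
    from DERIV_cdivide[OF DERIV_diff[OF this], of 2] show ?thesis
      by (simp add: V_def[abs_def] V'_def)
  qed
  have P_int: "(P' has_integral 0) {r..t}"
  proof -
    have "((\<lambda>s. V s * f s) has_vector_derivative P' s) (at s within {r..t})" if "s \<in> {r..t}" for s
      unfolding has_real_derivative_iff_has_vector_derivative[symmetric] P'_def
      by (rule has_field_derivative_at_within)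
         (use DERIV_mult[OF V_deriv[OF that] f_deriv[of s]] in \<open>simp add: algebra_simps\<close>)
    then have "(P' has_integral (V t * f t - V r * f r)) {r..t}"
      using order by (intro fundamental_theorem_of_calculus) auto
    moreover have "f t = 0" "f r = 0" using supp by (auto simp: f_def)
    ultimately show ?thesis by simp
  qed
  have A_cont: "continuous_on {r..t} A"
    unfolding A_def[abs_def] f_def using order by (intro continuous_intros g_cont) auto
  have B_cont: "continuous_on {r..t} B"
    unfolding B_def[abs_def] by (intro continuous_intros g'_cont)
  obtain iA iB where iA: "(A has_integral iA) {r..t}" and iB: "(B has_integral iB) {r..t}"
    using integrable_continuous_real[OF A_cont] integrable_continuous_real[OF B_cont]
    by (auto simp: integrable_on_def)
  have key: "A s + 4 * P' s \<le> B s" if s: "s \<in> {r..t}" for s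
  proof -
    have "(norm (g' s - V s *\<^sub>R g s))\<^sup>2 = (norm (g' s))\<^sup>2 - V s * f' s + (V s)\<^sup>2 * f s"
      unfolding f_def f'_def power2_norm_eq_inner
      by (simp add: inner_diff_left inner_diff_right inner_commute power2_eq_square algebra_simps)
    moreover have "- V' s - (V s)\<^sup>2 = (1 / (s - \<alpha>) + 1 / (\<beta> - s))\<^sup>2 / 4"
    proof -
      have "(x\<^sup>2 + y\<^sup>2) / 2 - ((x - y) / 2)\<^sup>2 = (x + y)\<^sup>2 / 4" for x y :: real
        by (simp add: power2_eq_square field_simps)
      from this[of "1 / (s - \<alpha>)" "1 / (\<beta> - s)"] show ?thesis
        unfolding V_def V'_def power_one_over by linarith
    qed
    then have "A s = 4 * f s * (- V' s - (V s)\<^sup>2)" by (simp add: A_def)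
    ultimately have "B s - (A s + 4 * P' s) = 4 * (norm (g' s - V s *\<^sub>R g s))\<^sup>2"
      by (simp add: B_def P'_def algebra_simps)
    then show ?thesis
      by (smt (verit) zero_le_power2)
  qed
  have "((\<lambda>s. A s + 4 * P' s) has_integral iA + 4 * 0) {r..t}"
    by (intro has_integral_add iA has_integral_mult_right P_int)
  then have "iA + 4 * 0 \<le> iB"
    by (rule has_integral_le[OF _ iB key])
  then have le: "iA \<le> iB" by simp
  have "(\<integral>\<^sup>+s\<in>{\<alpha><..<\<beta>}. ennreal (A s) \<partial>lborel) = (\<integral>\<^sup>+s\<in>{r..t}. ennreal (A s) \<partial>lborel)"
    using order supp by (intro nn_integral_cong) (force simp: indicator_def A_def f_def)
  also have "\<dots> = ennreal iA"
    by (rule nn_integral_has_integral_lebesgue'[OF _ iA]) (simp add: A_def f_def)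
  also have "\<dots> \<le> ennreal iB" using le by (rule ennreal_leI)
  also have "\<dots> = (\<integral>\<^sup>+s\<in>{r..t}. ennreal (B s) \<partial>lborel)"
    by (rule nn_integral_has_integral_lebesgue'[OF _ iB, symmetric]) (simp add: B_def)
  also have "\<dots> \<le> (\<integral>\<^sup>+s. 4 * (ennreal ((norm (g' s))\<^sup>2) * indicator {\<alpha><..<\<beta>} s) \<partial>lborel)"
    using order by (intro nn_integral_mono) (auto simp: indicator_def B_def ennreal_mult)
  also have "\<dots> = 4 * (\<integral>\<^sup>+s\<in>{\<alpha><..<\<beta>}. ennreal ((norm (g' s))\<^sup>2) \<partial>lborel)"
  proof (rule nn_integral_cmult)
    have [measurable]: "g' \<in> borel_measurable borel"
      using cont by (rule borel_measurable_continuous_onI)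
    show "(\<lambda>s. ennreal ((norm (g' s))\<^sup>2) * indicator {\<alpha><..<\<beta>} s) \<in> borel_measurable lborel"
      by measurable
  qed
  finally show ?thesis by (simp add: A_def f_def)
qed

section \<open>Integration along horizontal lines\<close>

text \<open>
  The left-invariant vector field \<open>e\<^sub>1 X\<^sub>1 + e\<^sub>2 X\<^sub>2\<close> for \<open>e = e\<^sub>1 + \<i> e\<^sub>2\<close>.
\<close>

definition hfield :: "complex \<Rightarrow> real^3 \<Rightarrow> real^3" where
  "hfield e x = Re e *\<^sub>R axis 1 1 + Im e *\<^sub>R axis 2 1
     + ((Re e * x$2 - Im e * x$1) / 2) *\<^sub>R axis 3 1"

lemma hfield_nth: "hfield e x $ 1 = Re e" "hfield e x $ 2 = Im e"
    "hfield e x $ 3 = (Re e * x$2 - Im e * x$1) / 2"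
  by (simp_all add: hfield_def axis_def)

text \<open>
  The field is constant along its own flow lines, which are therefore Euclidean straight lines.
\<close>

lemma hfield_flow: "hfield e (x + s *\<^sub>R hfield e x) = hfield e x"
  unfolding hfield_def[of e "x + s *\<^sub>R hfield e x"] hfield_def[of e x, symmetric]
  by (simp add: hfield_nth) (simp add: hfield_def algebra_simps)

lemma hproj_hfield: "hproj (hfield e x) = e"
  by (simp add: hproj_def hfield_nth)

lemma inner_hfield: "p \<bullet> hfield e x = hgrad p x \<bullet> e"
  by (simp add: inner_vec_def sum_3 hfield_nth hgrad_def inner_complex_def field_simps)

lemma hproj_flow: "hproj (x + s *\<^sub>R hfield e x) = hproj x + s *\<^sub>R e"
  by (simp add: hproj_def hfield_nth complex_eq_iff)

lemma continuous_on_hfield [continuous_intros]: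
  "continuous_on S h \<Longrightarrow> continuous_on S (\<lambda>z. hfield e (h z))"
  unfolding hfield_def by (intro continuous_intros) auto

text \<open>
  The flow at a fixed time is a translation after a linear map \<open>I + s N\<close> with \<open>N\<^sup>2 = 0\<close>, which has
  determinant one and inverse \<open>I - s N\<close>.
\<close>

lemma distr_lborel_flow:
  "distr lborel borel (\<lambda>x. x + s *\<^sub>R hfield e x) = (lborel :: (real^3) measure)"
proof -
  define N where "N x = ((Re e * x$2 - Im e * x$1) / 2) *\<^sub>R (axis 3 1 :: real^3)" for x :: "real^3"
  define T where "T s x = x + s *\<^sub>R N x" for s x
  have N_lin: "linear N"
    by (intro linearI) (simp_all add: N_def algebra_simps add_divide_distrib diff_divide_distrib)
  have T_lin: "linear (T s)" for s
    unfolding T_def[abs_def] by (intro linear_compose_add linear_ident linear_compose_scale_right N_lin)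
  have NN: "N (N x) = 0" for x by (simp add: N_def axis_def)
  have T_inv: "T s (T (- s) x) = x" for s x
    using N_lin by (simp add: T_def linear_add linear_scale linear_diff NN)
  have det: "det (matrix (T s)) = 1" for s
    by (simp add: det_3 matrix_def T_def N_def axis_def)
  have T_meas [measurable]: "T s \<in> borel_measurable borel" for s
    using T_lin by (intro borel_measurable_continuous_onI linear_continuous_on)
      (simp add: linear_conv_bounded_linear)
  have "lborel = distr lborel borel (T s)"
  proof (rule lborel_eqI)
    fix l u :: "real^3"
    assume lu: "\<And>b. b \<in> Basis \<Longrightarrow> l \<bullet> b \<le> u \<bullet> b"
    have vim: "T s -` box l u = T (- s) ` box l u"
      using T_inv[of s] T_inv[of "- s"] by (auto simp: image_iff) (metis add.inverse_inverse)
    have "emeasure (distr lborel borel (T s)) (box l u) = emeasure lebesgue (T (- s) ` box l u)"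
      by (simp add: emeasure_distr vim[symmetric] measurable_sets_borel[OF T_meas])
    also have "\<dots> = ennreal (measure lebesgue (T (- s) ` box l u))"
      by (intro emeasure_eq_measure2 measurable_linear_image[OF T_lin]) auto
    also have "\<dots> = ennreal (measure lebesgue (box l u))"
      by (subst measure_linear_image[OF T_lin]) (auto simp: det)
    also have "\<dots> = emeasure lborel (box l u)"
      by (simp add: emeasure_lborel_box_eq measure_lborel_box_eq lu)
    also have "\<dots> = (\<Prod>b\<in>Basis. (u - l) \<bullet> b)"
      using lu by (rule emeasure_lborel_box)
    finally show "emeasure (distr lborel borel (T s)) (box l u) = (\<Prod>b\<in>Basis. (u - l) \<bullet> b)" .
  qed simp
  then have "distr lborel borel ((+) (s *\<^sub>R (Re e *\<^sub>R axis 1 1 + Im e *\<^sub>R axis 2 1)) \<circ> T s)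
      = (lborel :: (real^3) measure)"
    by (subst distr_distr[symmetric, where N = borel]) (auto simp: lborel_distr_plus)
  moreover have "(+) (s *\<^sub>R (Re e *\<^sub>R axis 1 1 + Im e *\<^sub>R axis 2 1)) \<circ> T s = (\<lambda>x. x + s *\<^sub>R hfield e x)"
    by (auto simp: T_def N_def hfield_def algebra_simps)
  ultimately show ?thesis by simp
qed

text \<open>
  The flow moves the coordinate \<open>hproj x \<bullet> e\<close> with unit speed, so each line spends exactly unit
  time in the slab where this coordinate lies in \<open>[0, 1)\<close>.  By invariance of volume, integrating
  over the slab and then along the line through each of its points therefore covers the space
  once.  This takes the place of straightening the flow by a nonlinear change of variables.
\<close>

lemma nn_integral_horizontal_lines:
  assumes e: "norm e = 1" and F[measurable]: "F \<in> borel_measurable borel"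
  shows "(\<integral>\<^sup>+x. F x \<partial>lborel)
    = (\<integral>\<^sup>+x. indicator {0..<1} (hproj x \<bullet> e) * (\<integral>\<^sup>+s. F (x + s *\<^sub>R hfield e x) \<partial>lborel) \<partial>lborel)"
proof -
  have ee: "e \<bullet> e = 1" using e by (simp add: norm_eq_1)
  have [measurable]: "hproj \<in> borel_measurable borel"
    by (intro borel_measurable_continuous_onI linear_continuous_on bounded_linear_hproj)
  have flow[measurable]: "(\<lambda>z. fst z + snd z *\<^sub>R hfield e (fst z)) \<in> borel_measurable (borel \<Otimes>\<^sub>M borel)"
    unfolding borel_prod by (intro borel_measurable_continuous_onI continuous_intros)
  have [measurable]: "(\<lambda>x. x + s *\<^sub>R hfield e x) \<in> borel_measurable borel" for s
    by (intro borel_measurable_continuous_onI continuous_intros)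
  define h where "h s y = indicator {0..<1} (hproj y \<bullet> e - s) * F y" for s y
  have [measurable]: "h s \<in> borel_measurable borel" for s
    unfolding h_def by measurable
  have h_flow: "h s (x + s *\<^sub>R hfield e x) = indicator {0..<1} (hproj x \<bullet> e) * F (x + s *\<^sub>R hfield e x)" for s x
    by (simp add: h_def hproj_flow inner_add_left ee)
  have "(\<integral>\<^sup>+x. indicator {0..<1} (hproj x \<bullet> e) * (\<integral>\<^sup>+s. F (x + s *\<^sub>R hfield e x) \<partial>lborel) \<partial>lborel)
      = (\<integral>\<^sup>+x. (\<integral>\<^sup>+s. h s (x + s *\<^sub>R hfield e x) \<partial>lborel) \<partial>lborel)"
    unfolding h_flow
    by (intro nn_integral_cong nn_integral_cmult[symmetric])
       (auto intro!: measurable_compose[OF _ F] borel_measurable_continuous_onI continuous_intros)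
  also have "\<dots> = (\<integral>\<^sup>+s. (\<integral>\<^sup>+x. h s (x + s *\<^sub>R hfield e x) \<partial>lborel) \<partial>lborel)"
    unfolding h_flow
    by (rule lborel_pair.Fubini'[symmetric])
       (use flow in \<open>auto simp: split_beta' intro!: borel_measurable_times_ennreal measurable_compose[OF _ F]\<close>)
  also have "\<dots> = (\<integral>\<^sup>+s. (\<integral>\<^sup>+x. h s x \<partial>lborel) \<partial>lborel)"
  proof (rule nn_integral_cong)
    fix s
    have "(\<integral>\<^sup>+x. h s x \<partial>distr lborel borel (\<lambda>x. x + s *\<^sub>R hfield e x)) = (\<integral>\<^sup>+x. h s (x + s *\<^sub>R hfield e x) \<partial>lborel)"
      by (rule nn_integral_distr) auto
    then show "(\<integral>\<^sup>+x. h s (x + s *\<^sub>R hfield e x) \<partial>lborel) = (\<integral>\<^sup>+x. h s x \<partial>lborel)"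
      by (simp add: distr_lborel_flow)
  qed
  also have "\<dots> = (\<integral>\<^sup>+x. (\<integral>\<^sup>+s. h s x \<partial>lborel) \<partial>lborel)"
    unfolding h_def by (rule lborel_pair.Fubini') measurable
  also have "\<dots> = (\<integral>\<^sup>+x. F x \<partial>lborel)"
  proof (rule nn_integral_cong)
    fix x
    have ind: "indicator {0..<1} (hproj x \<bullet> e - s) = (indicator {hproj x \<bullet> e - 1<..hproj x \<bullet> e} s :: ennreal)" for s
      by (auto simp: indicator_def)
    show "(\<integral>\<^sup>+s. h s x \<partial>lborel) = F x"
      unfolding h_def ind by (subst nn_integral_multc) auto
  qed
  finally show ?thesis by simp
qed

section \<open>Hardy inequality with the sub-gradients of the facet planes\<close>

lemma bounded_open_convex_real_interval:
  fixes I :: "real set"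
  assumes "open I" "convex I" "bounded I" "I \<noteq> {}"
  obtains \<alpha> \<beta> where "\<alpha> < \<beta>" "I = {\<alpha><..<\<beta>}"
proof -
  have "compact (closure I)" "connected (closure I)"
    using assms by (auto intro: convex_connected convex_closure)
  then obtain \<alpha> \<beta> where cl: "closure I = {\<alpha>..\<beta>}"
    by (metis connected_compact_interval_1)
  have "I = interior (closure I)"
    using assms by (simp add: convex_interior_closure interior_open)
  then have "I = {\<alpha><..<\<beta>}" by (simp add: cl)
  moreover from this have "\<alpha> < \<beta>" using assms(4) by auto
  ultimately show ?thesis using that by blast
qed

lemma compact_subset_open_interval_shrink:
  fixes K :: "real set"
  assumes "compact K" "K \<subseteq> {\<alpha><..<\<beta>}" "\<alpha> < \<beta>"
  obtains r t where "\<alpha> < r" "r < t" "t < \<beta>" "K \<subseteq> {r<..<t}"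
proof (cases "K = {}")
  case True
  show ?thesis
    by (rule that[of "(2 * \<alpha> + \<beta>) / 3" "(\<alpha> + 2 * \<beta>) / 3"]) (use assms True in auto)
next
  case False
  obtain k where k: "k \<in> K" "\<And>s. s \<in> K \<Longrightarrow> k \<le> s"
    using compact_attains_inf[OF assms(1) False] by blast
  obtain k' where k': "k' \<in> K" "\<And>s. s \<in> K \<Longrightarrow> s \<le> k'"
    using compact_attains_sup[OF assms(1) False] by blast
  have b: "\<alpha> < k" "k' < \<beta>" "k \<le> k'" using k k' assms(2) by auto
  show ?thesis
  proof (rule that[of "(\<alpha> + k) / 2" "(k' + \<beta>) / 2"])
    show "K \<subseteq> {(\<alpha> + k) / 2<..<(k' + \<beta>) / 2}"
      using k(2) k'(2) b by fastforce
  qed (use b in auto)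
qed

text \<open>
  Unless \<open>B = 0\<close>, the left-hand side is the inverse square of the distance from \<open>s\<close> to the zero
  of the affine function, and this zero is at least as far away as one of the two end points.
\<close>

lemma affine_log_derivative_bound:
  fixes A B :: real
  assumes nz: "\<And>s. s \<in> {\<alpha><..<\<beta>} \<Longrightarrow> A + s * B \<noteq> 0" and s: "s \<in> {\<alpha><..<\<beta>}"
  shows "(B / (A + s * B))\<^sup>2 \<le> (1 / (s - \<alpha>) + 1 / (\<beta> - s))\<^sup>2"
proof (cases "B = 0")
  case False
  define \<rho> where "\<rho> = - A / B"
  have "A + \<rho> * B = 0" using False by (simp add: \<rho>_def)
  then have "\<rho> \<notin> {\<alpha><..<\<beta>}" using nz by blast
  then have cases: "\<rho> \<le> \<alpha> \<or> \<beta> \<le> \<rho>" by auto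
  have "A + s * B = B * (s - \<rho>)" using False by (simp add: \<rho>_def field_simps)
  then have eq: "\<bar>B / (A + s * B)\<bar> = 1 / \<bar>s - \<rho>\<bar>"
    using False by (simp add: abs_mult)
  have pos: "0 < s - \<alpha>" "0 < \<beta> - s" using s by auto
  have "1 / \<bar>s - \<rho>\<bar> \<le> 1 / (s - \<alpha>) + 1 / (\<beta> - s)"
    using cases
  proof
    assume "\<rho> \<le> \<alpha>"
    then have "1 / \<bar>s - \<rho>\<bar> \<le> 1 / (s - \<alpha>)" using pos by (intro divide_left_mono mult_pos_pos) auto
    then show ?thesis using pos by (simp add: add_increasing2)
  next
    assume "\<beta> \<le> \<rho>"
    then have "1 / \<bar>s - \<rho>\<bar> \<le> 1 / (\<beta> - s)" using pos by (intro divide_left_mono mult_pos_pos) auto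
    then show ?thesis using pos by (simp add: add_increasing)
  qed
  then have "\<bar>B / (A + s * B)\<bar> \<le> \<bar>1 / (s - \<alpha>) + 1 / (\<beta> - s)\<bar>"
    using eq by linarith
  then show ?thesis by (simp only: abs_le_square_iff)
qed simp

lemma hgrad_flow: "hgrad p (x + s *\<^sub>R hfield e x) \<bullet> e = hgrad p x \<bullet> e"
  by (simp add: hgrad_def hfield_nth inner_complex_def field_simps)

lemma frechet_derivative_hfield:
  assumes "u differentiable at x"
  shows "frechet_derivative u (at x) (hfield e x) = Re e *\<^sub>R frechet_derivative u (at x) (axis 1 1)
      + Im e *\<^sub>R frechet_derivative u (at x) (axis 2 1)
      + ((Re e * x$2 - Im e * x$1) / 2) *\<^sub>R frechet_derivative u (at x) (axis 3 1)"
  unfolding hfield_def using linear_frechet_derivative[OF assms]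
  by (simp add: linear_add linear_scale)

lemma continuous_on_derivative_hfield:
  fixes u :: "real^3 \<Rightarrow> 'a::real_normed_vector"
  assumes "\<And>x. u differentiable at x"
    and "\<And>v. continuous_on UNIV (\<lambda>x. frechet_derivative u (at x) v)"
  shows "continuous_on UNIV (\<lambda>x. frechet_derivative u (at x) (hfield e x))"
  unfolding frechet_derivative_hfield[OF assms(1)]
  by (intro continuous_intros assms) auto

lemma borel_measurable_SUP_hgrad_quotient [measurable]:
  assumes "finite P"
  shows "(\<lambda>x. SUP (p, c)\<in>P. ennreal (((hgrad p x \<bullet> e) / (p \<bullet> x - c))\<^sup>2)) \<in> borel_measurable borel"
proof -
  have [measurable]: "(\<lambda>x. hgrad p x \<bullet> e) \<in> borel_measurable borel" for p
    unfolding hgrad_def inner_complex_def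
    by (intro borel_measurable_continuous_onI) (auto intro!: continuous_intros)
  show ?thesis
    unfolding split_beta'
    by (intro borel_measurable_SUP) (auto simp: assms countable_finite)
qed

text \<open>
  Restricted to a flow line of \<open>hfield e\<close>, this is \<open>hardy_interval\<close> with the weight bounded from
  below by \<open>affine_log_derivative_bound\<close>, since the bound there is the same for all planes.
\<close>

lemma hardy_along_direction:
  fixes u :: "real^3 \<Rightarrow> 'a::euclidean_space" and P :: "((real^3) \<times> real) set"
  assumes \<Omega>: "open \<Omega>" "convex \<Omega>" "bounded \<Omega>"
    and P: "finite P" "\<And>p c x. (p, c) \<in> P \<Longrightarrow> x \<in> \<Omega> \<Longrightarrow> p \<bullet> x \<noteq> c"
    and e: "norm e = 1"
    and diff: "\<And>x. u differentiable at x"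
    and C1: "\<And>v. continuous_on UNIV (\<lambda>x. frechet_derivative u (at x) v)"
    and K: "compact K" "K \<subseteq> \<Omega>" "\<And>x. x \<notin> K \<Longrightarrow> u x = 0"
  shows "(\<integral>\<^sup>+x\<in>\<Omega>. ennreal ((norm (u x))\<^sup>2)
             * (SUP (p, c)\<in>P. ennreal (((hgrad p x \<bullet> e) / (p \<bullet> x - c))\<^sup>2)) \<partial>lborel)
         \<le> 4 * (\<integral>\<^sup>+x\<in>\<Omega>. ennreal ((norm (frechet_derivative u (at x) (hfield e x)))\<^sup>2) \<partial>lborel)"
proof -
  define S where "S x = (SUP (p, c)\<in>P. ennreal (((hgrad p x \<bullet> e) / (p \<bullet> x - c))\<^sup>2))" for x
  define Du where "Du x = frechet_derivative u (at x) (hfield e x)" for x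
  have Du_cont: "continuous_on UNIV Du"
    unfolding Du_def[abs_def] by (rule continuous_on_derivative_hfield[OF diff C1])
  have u_cont: "continuous_on UNIV u"
    using diff by (simp add: continuous_at_imp_continuous_on differentiable_imp_continuous_within)
  have [measurable]: "u \<in> borel_measurable borel" "Du \<in> borel_measurable borel" "\<Omega> \<in> sets borel"
    using u_cont Du_cont \<Omega>(1) by (auto intro: borel_measurable_continuous_onI)
  have [measurable]: "S \<in> borel_measurable borel"
    unfolding S_def[abs_def] by (rule borel_measurable_SUP_hgrad_quotient[OF P(1)])
  define L where "L x = ennreal ((norm (u x))\<^sup>2) * S x * indicator \<Omega> x" for x
  define R where "R x = 4 * (ennreal ((norm (Du x))\<^sup>2) * indicator \<Omega> x)" for x
  have [measurable]: "L \<in> borel_measurable borel" "R \<in> borel_measurable borel"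
    unfolding L_def R_def by measurable
  have line: "(\<integral>\<^sup>+s. L (x + s *\<^sub>R hfield e x) \<partial>lborel) \<le> (\<integral>\<^sup>+s. R (x + s *\<^sub>R hfield e x) \<partial>lborel)" for x
  proof -
    define v where "v = hfield e x"
    define I where "I = (\<lambda>s. x + s *\<^sub>R v) -` \<Omega>"
    have v0: "v \<noteq> 0" using e hproj_hfield[of e x] by (auto simp: v_def hproj_def zero_complex.code[symmetric])
    show ?thesis
    proof (cases "I = {}")
      case True
      then have "L (x + s *\<^sub>R hfield e x) = 0" for s
        by (auto simp: L_def I_def v_def indicator_def)
      then show ?thesis by simp
    next
      case False
      have "open I"
        unfolding I_def using \<Omega>(1) by (intro open_vimage) (auto intro!: continuous_intros)
      moreover have "convex I"
        unfolding convex_alt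
      proof (intro ballI allI impI)
        fix s t k :: real assume st: "s \<in> I" "t \<in> I" and k: "0 \<le> k \<and> k \<le> 1"
        have "(1 - k) *\<^sub>R (x + s *\<^sub>R v) + k *\<^sub>R (x + t *\<^sub>R v) \<in> \<Omega>"
          using \<Omega>(2) st k unfolding convex_alt I_def by auto
        moreover have "(1 - k) *\<^sub>R (x + s *\<^sub>R v) + k *\<^sub>R (x + t *\<^sub>R v) = x + ((1 - k) *\<^sub>R s + k *\<^sub>R t) *\<^sub>R v"
          by (simp add: algebra_simps)
        ultimately show "(1 - k) *\<^sub>R s + k *\<^sub>R t \<in> I" by (simp add: I_def)
      qed
      moreover have "bounded I"
      proof -
        obtain M where M: "\<And>y. y \<in> \<Omega> \<Longrightarrow> norm y \<le> M" using \<Omega>(3) by (auto simp: bounded_iff)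
        have "norm s \<le> (M + norm x) / norm v" if "s \<in> I" for s
        proof -
          have "\<bar>s\<bar> * norm v = norm ((x + s *\<^sub>R v) - x)" by simp
          also have "\<dots> \<le> norm (x + s *\<^sub>R v) + norm x" by (rule norm_triangle_ineq4)
          also have "\<dots> \<le> M + norm x" using M that by (simp add: I_def)
          finally show ?thesis using v0 by (simp add: field_simps)
        qed
        then show ?thesis by (auto simp: bounded_iff)
      qed
      ultimately obtain \<alpha> \<beta> where ab: "\<alpha> < \<beta>" and I: "I = {\<alpha><..<\<beta>}"
        using False by (rule bounded_open_convex_real_interval)
      \<comment> \<open>Compactness of the support gives a margin to the end points, as \<open>hardy_interval\<close> requires.\<close>
      define K' where "K' = (\<lambda>s. x + s *\<^sub>R v) -` K"
      have "K' \<subseteq> I" using K by (auto simp: K'_def I_def)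
      moreover have "compact K'"
      proof -
        have "closed K'"
          unfolding K'_def using K(1)
          by (intro closed_vimage compact_imp_closed continuous_intros)
        moreover have "bounded K'" using \<open>bounded I\<close> \<open>K' \<subseteq> I\<close> by (rule bounded_subset)
        ultimately show ?thesis by (simp add: compact_eq_bounded_closed)
      qed
      ultimately obtain r t where rt: "\<alpha> < r" "r < t" "t < \<beta>" and K'_sub: "K' \<subseteq> {r<..<t}"
        using compact_subset_open_interval_shrink ab I by metis
      define g where "g s = u (x + s *\<^sub>R v)" for s
      define g' where "g' s = Du (x + s *\<^sub>R v)" for s
      have g'_eq: "g' s = frechet_derivative u (at (x + s *\<^sub>R v)) v" for s
        by (simp add: g'_def Du_def v_def hfield_flow)
      have hardy: "(\<integral>\<^sup>+s\<in>{\<alpha><..<\<beta>}. ennreal ((norm (g s))\<^sup>2 * (1 / (s - \<alpha>) + 1 / (\<beta> - s))\<^sup>2) \<partial>lborel)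
          \<le> 4 * (\<integral>\<^sup>+s\<in>{\<alpha><..<\<beta>}. ennreal ((norm (g' s))\<^sup>2) \<partial>lborel)"
      proof (rule hardy_interval[OF _ _ rt])
        fix s
        have "(u has_derivative frechet_derivative u (at (x + s *\<^sub>R v))) (at (x + s *\<^sub>R v))"
          using diff frechet_derivative_works by blast
        moreover have "((\<lambda>s. x + s *\<^sub>R v) has_vector_derivative v) (at s)"
          by (auto intro!: derivative_eq_intros)
        ultimately show "(g has_vector_derivative g' s) (at s)"
          unfolding g_def[abs_def] g'_eq
          using vector_derivative_diff_chain_within[of "\<lambda>s. x + s *\<^sub>R v" v s UNIV u]
          by (simp add: o_def has_derivative_at_withinI)
      next
        show "continuous_on UNIV g'"
          unfolding g'_def[abs_def] by (intro continuous_on_compose2[OF Du_cont] continuous_intros) auto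
      next
        fix s assume "s \<notin> {r<..<t}"
        then have "x + s *\<^sub>R v \<notin> K" using K'_sub unfolding K'_def by blast
        then show "g s = 0" by (simp add: g_def K(3))
      qed
      have [measurable]: "g' \<in> borel_measurable borel"
        unfolding g'_def[abs_def]
        by (intro borel_measurable_continuous_onI continuous_on_compose2[OF Du_cont] continuous_intros) auto
      have mem: "x + s *\<^sub>R v \<in> \<Omega> \<longleftrightarrow> s \<in> {\<alpha><..<\<beta>}" for s
        using I by (auto simp: I_def)
      have "(\<integral>\<^sup>+s. L (x + s *\<^sub>R v) \<partial>lborel)
          \<le> (\<integral>\<^sup>+s\<in>{\<alpha><..<\<beta>}. ennreal ((norm (g s))\<^sup>2 * (1 / (s - \<alpha>) + 1 / (\<beta> - s))\<^sup>2) \<partial>lborel)"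
      proof (rule nn_integral_mono)
        fix s
        show "L (x + s *\<^sub>R v) \<le> ennreal ((norm (g s))\<^sup>2 * (1 / (s - \<alpha>) + 1 / (\<beta> - s))\<^sup>2) * indicator {\<alpha><..<\<beta>} s"
        proof (cases "s \<in> {\<alpha><..<\<beta>}")
          case True
          have "S (x + s *\<^sub>R v) \<le> ennreal ((1 / (s - \<alpha>) + 1 / (\<beta> - s))\<^sup>2)"
            unfolding S_def
          proof (rule SUP_least, clarify, rule ennreal_leI)
            fix p c assume pc: "(p, c) \<in> P"
            have eq: "p \<bullet> (x + s *\<^sub>R v) - c = (p \<bullet> x - c) + s * (hgrad p x \<bullet> e)" for s
              by (simp add: v_def inner_add_right inner_hfield)
            have "(p \<bullet> x - c) + s * (hgrad p x \<bullet> e) \<noteq> 0" if "s \<in> {\<alpha><..<\<beta>}" for s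
            proof -
              have "p \<bullet> (x + s *\<^sub>R v) \<noteq> c" using P(2)[OF pc] that mem by blast
              then show ?thesis by (simp only: eq[symmetric] right_minus_eq not_False_eq_True)
            qed
            from affine_log_derivative_bound[OF this True]
            show "((hgrad p (x + s *\<^sub>R v) \<bullet> e) / (p \<bullet> (x + s *\<^sub>R v) - c))\<^sup>2 \<le> (1 / (s - \<alpha>) + 1 / (\<beta> - s))\<^sup>2"
              unfolding eq by (simp add: v_def hgrad_flow)
          qed
          then show ?thesis
            using True mem by (simp add: L_def g_def ennreal_mult mult_left_mono)
        qed (use mem in \<open>simp add: L_def\<close>)
      qed
      also note hardy
      also have "4 * (\<integral>\<^sup>+s\<in>{\<alpha><..<\<beta>}. ennreal ((norm (g' s))\<^sup>2) \<partial>lborel) = (\<integral>\<^sup>+s. R (x + s *\<^sub>R v) \<partial>lborel)"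
        unfolding R_def
        by (subst nn_integral_cmult[symmetric]) (auto simp: g'_def mem indicator_def intro!: nn_integral_cong)
      finally show ?thesis by (simp add: v_def)
    qed
  qed
  have "(\<integral>\<^sup>+x. L x \<partial>lborel) \<le> (\<integral>\<^sup>+x. R x \<partial>lborel)"
    unfolding nn_integral_horizontal_lines[OF e \<open>L \<in> borel_measurable borel\<close>]
      nn_integral_horizontal_lines[OF e \<open>R \<in> borel_measurable borel\<close>]
    by (intro nn_integral_mono mult_left_mono line) auto
  also have "\<dots> = 4 * (\<integral>\<^sup>+x\<in>\<Omega>. ennreal ((norm (Du x))\<^sup>2) \<partial>lborel)"
    unfolding R_def by (rule nn_integral_cmult) measurable
  finally show ?thesis by (simp add: L_def S_def Du_def)
qed

text \<open>
  The smoothness in \<^const>\<open>C0_infinity\<close> is only required on \<open>\<Omega>\<close>; the zero extension keeps it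
  because \<open>\<Omega>\<close> and the complement of the support form an open cover of the space.
\<close>

lemma C0_infinity_extension_C1:
  assumes u: "u \<in> C0_infinity \<Omega>" and \<Omega>: "open \<Omega>"
  shows "u differentiable at x"
    and "continuous_on UNIV (\<lambda>x. frechet_derivative u (at x) v)"
proof -
  define K where "K = closure {x. u x \<noteq> 0}"
  have K: "closed K" "K \<subseteq> \<Omega>" "\<And>x. x \<notin> K \<Longrightarrow> u x = 0"
    using u closure_subset[of "{x. u x \<noteq> 0}"] by (auto simp: K_def C0_infinity_def)
  have "Ck_on 1 \<Omega> u" using u by (simp add: C0_infinity_def)
  then have in_\<Omega>: "\<And>x. x \<in> \<Omega> \<Longrightarrow> u differentiable at x"
    and cont: "continuous_on \<Omega> (\<lambda>x. frechet_derivative u (at x) v)"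
    by auto
  have outside: "(u has_derivative (\<lambda>_. 0)) (at x)" if "x \<in> - K" for x
    by (rule has_derivative_transform_within_open[of "\<lambda>_. 0" "\<lambda>_. 0" x UNIV "- K"])
       (use K that in auto)
  show "u differentiable at x"
    using in_\<Omega> outside K(2) by (cases "x \<in> K") (auto intro: differentiableI)
  have "frechet_derivative u (at x) v = 0" if "x \<in> - K" for x
    using frechet_derivative_at[OF outside[OF that]] by (metis)
  then have "continuous_on (- K) (\<lambda>x. frechet_derivative u (at x) v)"
    using continuous_on_cong[of "- K" "- K" "\<lambda>x. frechet_derivative u (at x) v" "\<lambda>_. 0"] by simp
  then have "continuous_on (\<Omega> \<union> - K) (\<lambda>x. frechet_derivative u (at x) v)"
    using cont K(1) \<Omega> by (intro continuous_on_open_Un) auto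
  moreover have "\<Omega> \<union> - K = UNIV" using K(2) by auto
  ultimately show "continuous_on UNIV (\<lambda>x. frechet_derivative u (at x) v)" by simp
qed

text \<open>
  Only the directions \<open>1\<close> and \<open>\<i>\<close> are needed: the maximum of a sum of two squares over the planes
  is at most the sum of the two separate maxima.
\<close>

lemma subgradient_hardy_hyperplanes:
  assumes \<Omega>: "open \<Omega>" "convex \<Omega>" "bounded \<Omega>"
    and P: "finite P" "\<And>p c x. (p, c) \<in> P \<Longrightarrow> x \<in> \<Omega> \<Longrightarrow> p \<bullet> x \<noteq> c"
    and u: "u \<in> C0_infinity \<Omega>"
  shows "(\<integral>\<^sup>+x\<in>\<Omega>. ennreal ((cmod (u x))\<^sup>2)
             * (SUP (p, c)\<in>P. ennreal ((norm (hgrad p x) / (p \<bullet> x - c))\<^sup>2)) \<partial>lborel)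
         \<le> 4 * (\<integral>\<^sup>+x\<in>\<Omega>. ennreal (subgrad_norm_sq u x) \<partial>lborel)"
proof -
  define S where "S e x = (SUP (p, c)\<in>P. ennreal (((hgrad p x \<bullet> e) / (p \<bullet> x - c))\<^sup>2))" for e x
  define D where "D e x = frechet_derivative u (at x) (hfield e x)" for e x
  note C1 = C0_infinity_extension_C1[OF u \<Omega>(1)]
  have hardy: "(\<integral>\<^sup>+x\<in>\<Omega>. ennreal ((cmod (u x))\<^sup>2) * S e x \<partial>lborel)
      \<le> 4 * (\<integral>\<^sup>+x\<in>\<Omega>. ennreal ((cmod (D e x))\<^sup>2) \<partial>lborel)" if "norm e = 1" for e
    unfolding S_def D_def
  proof (rule hardy_along_direction[OF \<Omega> P that C1])
    show "compact (closure {x. u x \<noteq> 0})" "closure {x. u x \<noteq> 0} \<subseteq> \<Omega>"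
      using u by (auto simp: C0_infinity_def)
    show "u x = 0" if "x \<notin> closure {x. u x \<noteq> 0}" for x
      using that closure_subset[of "{x. u x \<noteq> 0}"] by blast
  qed
  have [measurable]: "D e \<in> borel_measurable borel" for e
    unfolding D_def[abs_def] by (intro borel_measurable_continuous_onI continuous_on_derivative_hfield C1)
  have [measurable]: "u \<in> borel_measurable borel"
    using C1(1) by (intro borel_measurable_continuous_onI)
      (simp add: continuous_at_imp_continuous_on differentiable_imp_continuous_within)
  have [measurable]: "\<Omega> \<in> sets borel" using \<Omega>(1) by simp
  have [measurable]: "S e \<in> borel_measurable borel" for e
    unfolding S_def[abs_def] by (rule borel_measurable_SUP_hgrad_quotient[OF P(1)])
  have subgrad: "subgrad_norm_sq u x = (cmod (D 1 x))\<^sup>2 + (cmod (D \<i> x))\<^sup>2" for x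
    by (simp add: subgrad_norm_sq_def X1_def X2_def partial_deriv_def D_def frechet_derivative_hfield[OF C1(1)])
  have weight: "(SUP (p, c)\<in>P. ennreal ((norm (hgrad p x) / (p \<bullet> x - c))\<^sup>2)) \<le> S 1 x + S \<i> x" for x
  proof (rule SUP_least, clarify)
    fix p c assume pc: "(p, c) \<in> P"
    have "(norm (hgrad p x) / (p \<bullet> x - c))\<^sup>2
        = ((hgrad p x \<bullet> 1) / (p \<bullet> x - c))\<^sup>2 + ((hgrad p x \<bullet> \<i>) / (p \<bullet> x - c))\<^sup>2"
      by (simp add: power_divide cmod_power2 inner_complex_def add_divide_distrib)
    then have "ennreal ((norm (hgrad p x) / (p \<bullet> x - c))\<^sup>2)
        = ennreal (((hgrad p x \<bullet> 1) / (p \<bullet> x - c))\<^sup>2) + ennreal (((hgrad p x \<bullet> \<i>) / (p \<bullet> x - c))\<^sup>2)"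
      by simp
    also have "\<dots> \<le> S 1 x + S \<i> x"
      unfolding S_def using pc by (intro add_mono SUP_upper2[of "(p, c)"]) auto
    finally show "ennreal ((norm (hgrad p x) / (p \<bullet> x - c))\<^sup>2) \<le> S 1 x + S \<i> x" .
  qed
  have "(\<integral>\<^sup>+x\<in>\<Omega>. ennreal ((cmod (u x))\<^sup>2)
        * (SUP (p, c)\<in>P. ennreal ((norm (hgrad p x) / (p \<bullet> x - c))\<^sup>2)) \<partial>lborel)
      \<le> (\<integral>\<^sup>+x\<in>\<Omega>. ennreal ((cmod (u x))\<^sup>2) * (S 1 x + S \<i> x) \<partial>lborel)"
    by (intro nn_integral_mono mult_right_mono mult_left_mono weight) auto
  also have "\<dots> = (\<integral>\<^sup>+x\<in>\<Omega>. ennreal ((cmod (u x))\<^sup>2) * S 1 x \<partial>lborel)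
      + (\<integral>\<^sup>+x\<in>\<Omega>. ennreal ((cmod (u x))\<^sup>2) * S \<i> x \<partial>lborel)"
    unfolding distrib_left distrib_right by (rule nn_integral_add) measurable
  also have "\<dots> \<le> 4 * (\<integral>\<^sup>+x\<in>\<Omega>. ennreal ((cmod (D 1 x))\<^sup>2) \<partial>lborel)
      + 4 * (\<integral>\<^sup>+x\<in>\<Omega>. ennreal ((cmod (D \<i> x))\<^sup>2) \<partial>lborel)"
    by (intro add_mono hardy) simp_all
  also have "\<dots> = 4 * (\<integral>\<^sup>+x. ennreal ((cmod (D 1 x))\<^sup>2) * indicator \<Omega> x
      + ennreal ((cmod (D \<i> x))\<^sup>2) * indicator \<Omega> x \<partial>lborel)"
    by (subst nn_integral_add) (auto simp: distrib_left)
  also have "\<dots> = 4 * (\<integral>\<^sup>+x\<in>\<Omega>. ennreal (subgrad_norm_sq u x) \<partial>lborel)"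
    by (simp add: subgrad ennreal_plus distrib_right)
  finally show ?thesis .
qed

section \<open>The facet planes of the polytope\<close>

lemma polytope_boundary_hyperplanes:
  assumes "open_convex_polytope \<Omega>"
  shows "finite (boundary_hyperplanes \<Omega>)"
    and "frontier \<Omega> \<subseteq> \<Union>(boundary_hyperplanes \<Omega>)"
    and "H \<in> boundary_hyperplanes \<Omega> \<Longrightarrow> H \<inter> \<Omega> = {}"
proof -
  have \<Omega>: "open \<Omega>" "convex \<Omega>" and poly: "polytope (closure \<Omega>)"
    using assms by (auto simp: open_convex_polytope_def)
  have hedron: "polyhedron (closure \<Omega>)" using poly by (rule polytope_imp_polyhedron)
  show "finite (boundary_hyperplanes \<Omega>)"
    using finite_polytope_facets[OF poly] by (simp add: boundary_hyperplanes_def setcompr_eq_image)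
  have int: "interior (closure \<Omega>) = \<Omega>"
    using \<Omega> by (simp add: convex_interior_closure interior_open)
  show "frontier \<Omega> \<subseteq> \<Union>(boundary_hyperplanes \<Omega>)"
  proof (cases "\<Omega> = {}")
    case False
    then have "rel_interior (closure \<Omega>) = \<Omega>"
      using rel_interior_nonempty_interior[of "closure \<Omega>"] int by simp
    then have "frontier \<Omega> = rel_frontier (closure \<Omega>)"
      using \<Omega> by (simp add: frontier_def rel_frontier_def interior_open)
    also have "\<dots> = \<Union>{F. F facet_of closure \<Omega>}"
      using hedron by (rule rel_frontier_of_polyhedron)
    finally show ?thesis
      using hull_subset by (fastforce simp: boundary_hyperplanes_def)
  qed simp
  assume "H \<in> boundary_hyperplanes \<Omega>"
  then obtain F where F: "F facet_of closure \<Omega>" and H: "H = affine hull F"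
    by (auto simp: boundary_hyperplanes_def)
  obtain a b where ab: "a \<noteq> 0" "closure \<Omega> \<subseteq> {x. a \<bullet> x \<le> b}" "F = closure \<Omega> \<inter> {x. a \<bullet> x = b}"
    using facet_of_polyhedron[OF hedron F] by metis
  have "H \<subseteq> {x. a \<bullet> x = b}"
    unfolding H using ab(3) by (intro hull_minimal affine_hyperplane) auto
  moreover have "\<Omega> \<subseteq> {x. a \<bullet> x < b}"
    using interior_mono[OF ab(2)] ab(1) by (simp add: int)
  ultimately show "H \<inter> \<Omega> = {}" by force
qed

text \<open>
  Links the hypothesis of the theorem, phrased with the characteristic point of the plane, to the
  sub-gradient.
\<close>

lemma norm_hgrad_sq:
  assumes "p$3 \<noteq> 0"
  shows "4 * (norm (hgrad p x))\<^sup>2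
    = (p$3)\<^sup>2 * ((- (2 * p$2 / p$3) + x$1)\<^sup>2 + (2 * p$1 / p$3 + x$2)\<^sup>2)"
proof -
  have "4 * (norm (hgrad p x))\<^sup>2 = (2 * p$2 - p$3 * x$1)\<^sup>2 + (2 * p$1 + p$3 * x$2)\<^sup>2"
    unfolding cmod_power2 by (simp add: hgrad_def power2_eq_square field_simps)
  also have "2 * p$2 - p$3 * x$1 = - (p$3 * (- (2 * p$2 / p$3) + x$1))"
    using assms by (simp add: field_simps)
  also have "2 * p$1 + p$3 * x$2 = p$3 * (2 * p$1 / p$3 + x$2)"
    using assms by (simp add: field_simps)
  finally show ?thesis by (simp only: power2_minus power_mult_distrib distrib_left[of "(p$3)\<^sup>2"])
qed

lemma vertical_hyperplane_normal:
  assumes "hyperplanes_orthogonal H {x. x$3 = 0}"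
  obtains p c where "p \<noteq> 0" "p$3 = 0" "H = {y. p \<bullet> y = c}"
proof -
  obtain p q c d where *: "p \<noteq> 0" "q \<noteq> 0" "H = {y. p \<bullet> y = c}"
    "{x. x$3 = 0} = {y. q \<bullet> y = d}" "orthogonal p q"
    using assms unfolding hyperplanes_orthogonal_def by blast
  have mem: "q \<bullet> y = d" if "y$3 = 0" for y using *(4) that by auto
  have d: "d = 0" using mem[of 0] by simp
  have "q$1 = 0" "q$2 = 0"
    using mem[of "axis 1 1"] mem[of "axis 2 1"] d by (simp_all add: inner_vec_def sum_3 axis_def)
  moreover from this have "q$3 \<noteq> 0" using *(2) by (auto simp: vec_eq_iff forall_3)
  ultimately have "p$3 = 0" using *(5) by (simp add: orthogonal_def inner_vec_def sum_3)
  then show ?thesis using * that by blast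
qed

text \<open>
  Vertical planes satisfy the same estimate as the others because the third component of their
  normal vanishes.
\<close>

lemma boundary_hyperplane_normal:
  fixes \<Omega> :: "(real^3) set" and n1 n2 n3 c :: "nat \<Rightarrow> real"
  assumes normals: "(\<lambda>j. {y :: real^3. n1 j * y$1 + n2 j * y$2 + n3 j * y$3 = c j}) ` J
      = nonvertical_hyperplanes \<Omega>"
    and n3: "\<forall>j\<in>J. n3 j \<noteq> 0"
    and bound: "\<forall>x\<in>\<Omega>. \<forall>j\<in>J.
           (- (2 * n2 j / n3 j) + x$1)\<^sup>2 + (2 * n1 j / n3 j + x$2)\<^sup>2
             \<ge> a * \<bar>- (c j / n3 j) + x$3 + x$1 * n1 j / n3 j + x$2 * n2 j / n3 j\<bar>"
    and H: "H \<in> boundary_hyperplanes \<Omega>"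
  obtains p d where "p \<noteq> 0" "H = {y. p \<bullet> y = d}"
    "\<And>x. x \<in> \<Omega> \<Longrightarrow> a * \<bar>p$3\<bar> * \<bar>p \<bullet> x - d\<bar> \<le> 4 * (norm (hgrad p x))\<^sup>2"
proof (cases "H \<in> nonvertical_hyperplanes \<Omega>")
  case True
  then obtain j where j: "j \<in> J"
    and Hj: "H = {y. n1 j * y$1 + n2 j * y$2 + n3 j * y$3 = c j}"
    using normals by blast
  define p where "p = (vector [n1 j, n2 j, n3 j] :: real^3)"
  have p: "p$1 = n1 j" "p$2 = n2 j" "p$3 = n3 j" by (simp_all add: p_def)
  have n3j: "n3 j \<noteq> 0" using n3 j by blast
  show ?thesis
  proof (rule that)
    show "p \<noteq> 0" using n3j p(3) by auto
    show "H = {y. p \<bullet> y = c j}" by (simp add: Hj inner_vec_def sum_3 p)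
    fix x assume x: "x \<in> \<Omega>"
    have "p \<bullet> x - c j = n3 j * (- (c j / n3 j) + x$3 + x$1 * n1 j / n3 j + x$2 * n2 j / n3 j)"
      using n3j by (simp add: inner_vec_def sum_3 p field_simps)
    then have "a * \<bar>p$3\<bar> * \<bar>p \<bullet> x - c j\<bar>
        = (n3 j)\<^sup>2 * (a * \<bar>- (c j / n3 j) + x$3 + x$1 * n1 j / n3 j + x$2 * n2 j / n3 j\<bar>)"
      by (simp add: abs_mult p power2_eq_square)
    also have "\<dots> \<le> (n3 j)\<^sup>2 * ((- (2 * n2 j / n3 j) + x$1)\<^sup>2 + (2 * n1 j / n3 j + x$2)\<^sup>2)"
      using bound x j by (intro mult_left_mono) auto
    also have "\<dots> = 4 * (norm (hgrad p x))\<^sup>2"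
      using norm_hgrad_sq[of p x] n3j by (simp add: p)
    finally show "a * \<bar>p$3\<bar> * \<bar>p \<bullet> x - c j\<bar> \<le> 4 * (norm (hgrad p x))\<^sup>2" .
  qed
next
  case False
  then have "hyperplanes_orthogonal H {x. x$3 = 0}"
    using H by (simp add: nonvertical_hyperplanes_def)
  then obtain p d where "p \<noteq> 0" "p$3 = 0" "H = {y. p \<bullet> y = d}"
    by (rule vertical_hyperplane_normal)
  then show ?thesis by (intro that) auto
qed

section \<open>The distance to the boundary\<close>

lemma ennreal_inverse_antimono: "x \<le> y \<Longrightarrow> inverse y \<le> inverse (x :: ennreal)"
proof (cases x; cases y)
  fix r s assume xy: "x \<le> y" "0 \<le> r" "x = ennreal r" "0 \<le> s" "y = ennreal s"
  show ?thesis
    using xy by (cases "r = 0") (auto simp: inverse_ennreal intro!: ennreal_leI le_imp_inverse_le)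
qed (auto simp: top_unique)

text \<open>
  A curve to the boundary ends on some facet plane, so the distance to the boundary is at least
  the smallest of the bounds from \<open>cc_dist_hyperplane_lower_bound\<close>; the smallest bound belongs to
  the plane that maximises the weight.  Stating this with both factors multiplied out avoids
  division by an infinite distance or an empty maximum.
\<close>

lemma cc_dist_frontier_lower_bound:
  fixes a :: real and A :: ennreal
  assumes a: "a > 0" and x: "x \<in> \<Omega>"
    and P: "finite P" "\<And>p c. (p, c) \<in> P \<Longrightarrow> p \<bullet> x \<noteq> c" "\<And>p c. (p, c) \<in> P \<Longrightarrow> p \<noteq> 0"
    and bound: "\<And>p c. (p, c) \<in> P \<Longrightarrow> a * \<bar>p$3\<bar> * \<bar>p \<bullet> x - c\<bar> \<le> 4 * (norm (hgrad p x))\<^sup>2"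
    and frontier: "\<And>y. y \<in> frontier \<Omega> \<Longrightarrow> \<exists>(p, c)\<in>P. p \<bullet> y = c"
  shows "ennreal ((48 * sqrt 6 / a + 1) powr (- 4 / 3)) * (A / (cc_dist_frontier \<Omega> x)\<^sup>2)
      \<le> A * (SUP (p, c)\<in>P. ennreal ((norm (hgrad p x) / (p \<bullet> x - c))\<^sup>2))"
proof (cases "P = {}")
  case True
  then have "frontier \<Omega> = {}" using frontier by auto
  then show ?thesis by (simp add: cc_dist_frontier_def)
next
  case False
  \<comment> \<open>No plane parallel to one of the given planes is characteristic at \<open>x\<close>.\<close>
  have hgrad: "hgrad p x \<noteq> 0" if pc: "(p, c) \<in> P" for p c
  proof
    assume 0: "hgrad p x = 0"
    then have "a * \<bar>p$3\<bar> * \<bar>p \<bullet> x - c\<bar> \<le> 0" using bound[OF pc] by simp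
    then have "p$3 = 0" using P(2)[OF pc] a by (auto simp: mult_le_0_iff)
    with 0 have "p = 0" by (simp add: hgrad_def complex_eq_iff vec_eq_iff forall_3)
    with P(3)[OF pc] show False ..
  qed
  define k where "k = (48 * sqrt 6 / a + 1) powr (- 2 / 3)"
  have base: "48 * sqrt 6 / a + 1 \<ge> 1" using a by simp
  have k0: "k > 0" using base by (simp add: k_def)
  have k2: "(48 * sqrt 6 / a + 1) powr (- 4 / 3) = k\<^sup>2"
    using base by (simp add: k_def power2_eq_square flip: powr_add)
  define r where "r pc = \<bar>fst pc \<bullet> x - snd pc\<bar> / norm (hgrad (fst pc) x)" for pc
  have "Min (r ` P) \<in> r ` P" using P(1) False by (intro Min_in) auto
  then obtain p c where pc: "(p, c) \<in> P" and "r (p, c) = Min (r ` P)" by auto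
  then have min: "r (p, c) \<le> r pc'" if "pc' \<in> P" for pc'
    using that P(1) by simp
  have rpos: "r (p, c) > 0" using P(2)[OF pc] hgrad[OF pc] by (simp add: r_def)
  have "ennreal (k * r (p, c)) \<le> cc_dist_frontier \<Omega> x"
    unfolding cc_dist_frontier_def
  proof (rule INF_greatest)
    fix y assume "y \<in> frontier \<Omega>"
    then obtain q b where qb: "(q, b) \<in> P" "q \<bullet> y = b" using frontier by blast
    have "ennreal (k * \<bar>q \<bullet> x - b\<bar> / norm (hgrad q x)) \<le> cc_dist x y"
      unfolding k_def
      using a P(2)[OF qb(1)] qb(2) hgrad[OF qb(1)] bound[OF qb(1)]
      by (rule cc_dist_hyperplane_lower_bound)
    moreover have "k * r (p, c) \<le> k * \<bar>q \<bullet> x - b\<bar> / norm (hgrad q x)"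
      using mult_left_mono[OF min[OF qb(1)], of k] k0 by (simp add: r_def)
    ultimately show "ennreal (k * r (p, c)) \<le> cc_dist x y"
      by (meson ennreal_leI order_trans)
  qed
  then have "ennreal (k\<^sup>2) * (A / (cc_dist_frontier \<Omega> x)\<^sup>2)
      \<le> ennreal (k\<^sup>2) * (A / (ennreal (k * r (p, c)))\<^sup>2)"
    unfolding divide_ennreal_def
    by (intro mult_left_mono ennreal_inverse_antimono power_mono) auto
  also have "\<dots> = A * ennreal (1 / (r (p, c))\<^sup>2)"
  proof -
    have "ennreal (k\<^sup>2) * (A / (ennreal (k * r (p, c)))\<^sup>2)
        = A * (ennreal (k\<^sup>2) * ennreal (1 / (k * r (p, c))\<^sup>2))"
      using k0 rpos
      by (simp add: divide_ennreal_def ennreal_power inverse_ennreal divide_inverse mult_ac)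
    also have "ennreal (k\<^sup>2) * ennreal (1 / (k * r (p, c))\<^sup>2) = ennreal (1 / (r (p, c))\<^sup>2)"
      using k0 by (simp add: ennreal_mult[symmetric] power_mult_distrib)
    finally show ?thesis .
  qed
  also have "1 / (r (p, c))\<^sup>2 = (norm (hgrad p x) / (p \<bullet> x - c))\<^sup>2"
    by (simp add: r_def power_divide)
  also have "A * ennreal \<dots> \<le> A * (SUP (p, c)\<in>P. ennreal ((norm (hgrad p x) / (p \<bullet> x - c))\<^sup>2))"
    using pc by (intro mult_left_mono SUP_upper2[of "(p, c)"]) auto
  finally show ?thesis unfolding k2 .
qed

theorem theorem6p2:
  fixes \<Omega> :: "(real^3) set" and m :: nat
    and n1 n2 n3 c :: "nat \<Rightarrow> real" and a :: real
  assumes "open_convex_polytope \<Omega>"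
    and "m = card (nonvertical_hyperplanes \<Omega>)"
    and "bij_betw (\<lambda>j. {y :: real^3. n1 j * y$1 + n2 j * y$2 + n3 j * y$3 = c j})
           {1..m} (nonvertical_hyperplanes \<Omega>)"
    and "\<forall>j\<in>{1..m}. n3 j \<noteq> 0"
    and "a > 0"
    and "\<forall>x\<in>\<Omega>. \<forall>j\<in>{1..m}.
           (- (2 * n2 j / n3 j) + x$1)\<^sup>2 + (2 * n1 j / n3 j + x$2)\<^sup>2
             \<ge> a * \<bar>- (c j / n3 j) + x$3 + x$1 * n1 j / n3 j + x$2 * n2 j / n3 j\<bar>"
  shows "\<forall>u \<in> C0_infinity \<Omega>.
           ennreal ((48 * sqrt 6 / a + 1) powr (- 4 / 3))
             * (\<integral>\<^sup>+x\<in>\<Omega>. ennreal ((cmod (u x))\<^sup>2) / (cc_dist_frontier \<Omega> x)\<^sup>2 \<partial>lborel)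
           \<le> 4 * (\<integral>\<^sup>+x\<in>\<Omega>. ennreal (subgrad_norm_sq u x) \<partial>lborel)"
proof
  fix u assume u: "u \<in> C0_infinity \<Omega>"
  have \<Omega>: "open \<Omega>" "convex \<Omega>" "bounded \<Omega>"
    using assms(1) closure_subset[of \<Omega>]
    by (auto simp: open_convex_polytope_def intro: bounded_subset polytope_imp_bounded)
  note planes = polytope_boundary_hyperplanes[OF assms(1)]
  have "(\<lambda>j. {y :: real^3. n1 j * y$1 + n2 j * y$2 + n3 j * y$3 = c j}) ` {1..m}
      = nonvertical_hyperplanes \<Omega>"
    using assms(3) by (simp only: bij_betw_def)
  note normal = boundary_hyperplane_normal[OF this assms(4,6)]
  have "\<exists>p d. p \<noteq> 0 \<and> H = {y. p \<bullet> y = d} \<and>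
      (\<forall>x\<in>\<Omega>. a * \<bar>p$3\<bar> * \<bar>p \<bullet> x - d\<bar> \<le> 4 * (norm (hgrad p x))\<^sup>2)"
    if "H \<in> boundary_hyperplanes \<Omega>" for H
    using normal[OF that] by metis
  then obtain n b where nb: "\<And>H. H \<in> boundary_hyperplanes \<Omega> \<Longrightarrow>
      n H \<noteq> 0 \<and> H = {y. n H \<bullet> y = b H} \<and>
      (\<forall>x\<in>\<Omega>. a * \<bar>n H $ 3\<bar> * \<bar>n H \<bullet> x - b H\<bar> \<le> 4 * (norm (hgrad (n H) x))\<^sup>2)"
    by metis
  define P where "P = (\<lambda>H. (n H, b H)) ` boundary_hyperplanes \<Omega>"
  have P_fin: "finite P" using planes(1) by (simp add: P_def)
  have P: "p \<noteq> 0 \<and> (\<forall>x\<in>\<Omega>. p \<bullet> x \<noteq> d \<and>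
      a * \<bar>p$3\<bar> * \<bar>p \<bullet> x - d\<bar> \<le> 4 * (norm (hgrad p x))\<^sup>2)" if "(p, d) \<in> P" for p d
  proof -
    obtain H where H: "H \<in> boundary_hyperplanes \<Omega>" and pd: "p = n H" "d = b H"
      using \<open>(p, d) \<in> P\<close> by (auto simp: P_def)
    have "x \<notin> {y. n H \<bullet> y = b H}" if "x \<in> \<Omega>" for x
      using planes(3)[OF H] nb[OF H] that by (metis disjoint_iff)
    then show ?thesis using nb[OF H] unfolding pd by blast
  qed
  have P_frontier: "\<exists>(p, d)\<in>P. p \<bullet> y = d" if "y \<in> frontier \<Omega>" for y
  proof -
    obtain H where H: "H \<in> boundary_hyperplanes \<Omega>" "y \<in> H"
      using planes(2) \<open>y \<in> frontier \<Omega>\<close> by blast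
    have "y \<in> {y. n H \<bullet> y = b H}" using nb[OF H(1)] H(2) by (metis (no_types))
    then show ?thesis using H(1) unfolding P_def by blast
  qed
  let ?W = "\<lambda>x. SUP (p, d)\<in>P. ennreal ((norm (hgrad p x) / (p \<bullet> x - d))\<^sup>2)"
  let ?k = "ennreal ((48 * sqrt 6 / a + 1) powr (- 4 / 3))"
  have "?k * (\<integral>\<^sup>+x\<in>\<Omega>. ennreal ((cmod (u x))\<^sup>2) / (cc_dist_frontier \<Omega> x)\<^sup>2 \<partial>lborel)
      \<le> (\<integral>\<^sup>+x. ?k * (ennreal ((cmod (u x))\<^sup>2) / (cc_dist_frontier \<Omega> x)\<^sup>2 * indicator \<Omega> x) \<partial>lborel)"
    by (rule cmult_nn_integral_le)
  also have "\<dots> \<le> (\<integral>\<^sup>+x\<in>\<Omega>. ennreal ((cmod (u x))\<^sup>2) * ?W x \<partial>lborel)"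
  proof (rule nn_integral_mono)
    fix x
    show "?k * (ennreal ((cmod (u x))\<^sup>2) / (cc_dist_frontier \<Omega> x)\<^sup>2 * indicator \<Omega> x)
        \<le> ennreal ((cmod (u x))\<^sup>2) * ?W x * indicator \<Omega> x"
    proof (cases "x \<in> \<Omega>")
      case True
      have "?k * (ennreal ((cmod (u x))\<^sup>2) / (cc_dist_frontier \<Omega> x)\<^sup>2) \<le> ennreal ((cmod (u x))\<^sup>2) * ?W x"
        by (rule cc_dist_frontier_lower_bound[OF assms(5) True P_fin])
           (use P P_frontier True in blast)+
      then show ?thesis using True by simp
    qed simp
  qed
  also have "\<dots> \<le> 4 * (\<integral>\<^sup>+x\<in>\<Omega>. ennreal (subgrad_norm_sq u x) \<partial>lborel)"
    using P by (intro subgradient_hardy_hyperplanes \<Omega> P_fin u) blast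
  finally show "?k * (\<integral>\<^sup>+x\<in>\<Omega>. ennreal ((cmod (u x))\<^sup>2) / (cc_dist_frontier \<Omega> x)\<^sup>2 \<partial>lborel)
      \<le> 4 * (\<integral>\<^sup>+x\<in>\<Omega>. ennreal (subgrad_norm_sq u x) \<partial>lborel)" .
qed

end
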